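(* Let $\Omega=[0,1]^d$ and $s\ge0$. Assume that $V\in\mathcal{B}^s(\Omega)$ and that there are finite positive constants $V_{\min},V_{\max}$ with $V_{\min}\le V(x)\le V_{\max}$ for every $x\in\Omega$. Let $u^\ast$ be the ground state of the Schrödinger operator $\mathcal{H}=-\Delta+V$ on $\Omega$ with Neumann boundary condition. Then $u^\ast\in\mathcal{B}^{s+2}(\Omega)$.
   Context: Spectral Barron space. For $k\in\mathbb{N}_0^d$ let $\Phi_k(x)=\prod_{i=1}^d\cos(\pi k_ix_i)$, and let $\hat u(k)$ be the coefficients of $u\in L^1(\Omega)$ in the expansion in $\{\Phi_k\}$, i.e. $\hat u(k)=\int_\Omega u\Phi_k\,/\int_\Omega\Phi_k^2$. For $s\ge0$, $\mathcal{B}^s(\Omega)=\{u\in L^1(\Omega):\|u\|_{\mathcal{B}^s(\Omega)}<\infty\}$ with $\|u\|_{\mathcal{B}^s(\Omega)}=\sum_{k\in\mathbb{N}_0^d}(1+\pi^s|k|_1^s)|\hat u(k)|$, where $|k|_1$ is the $\ell^1$-norm; it is a Banach space embedded in $C(\overline\Omega)$. Ground state. The smallest eigenvalue $\lambda^\ast$ of the Neumann problem $-\Delta u+Vu=\lambda u$ in $\Omega$, $\partial u/\partial\nu=0$ on $\partial\Omega$, is $\lambda^\ast=\min_{u\in H^1(\Omega)\setminus\{0\}}\frac{\int_\Omega|\nabla u|^2+V|u|^2}{\int_\Omega|u|^2}$; the ground state $u^\ast\in H^1(\Omega)$ is the corresponding minimizer/eigenfunction, unique up to a multiplicative constant and strictly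 positive up to sign, normalized by $\|u^\ast\|_{L^2(\Omega)}=1$. *)

theory Defs
  imports "HOL-Analysis.Analysis"
begin

text \<open>
  The domain is the closed unit cube in \<open>real ^ 'n\<close>, with dimension \<open>d = CARD('n) \<ge> 1\<close>.
  Functions on the cube are total functions of which only the values on the cube matter;
  elements of \<open>L\<^sup>1\<close>, \<open>L\<^sup>2\<close> and \<open>H\<^sup>1\<close> are represented by arbitrary members of their a.e. classes.
\<close>

abbreviation unit_cube :: "(real ^ 'n) set" where
  "unit_cube \<equiv> cbox 0 1"

subsection \<open>The spectral Barron space\<close>

definition cos_basis :: "nat ^ 'n \<Rightarrow> real ^ 'n \<Rightarrow> real" where
  "cos_basis k x = (\<Prod>i\<in>UNIV. cos (pi * real (k $ i) * x $ i))"

definition cos_coeff :: "(real ^ 'n \<Rightarrow> real) \<Rightarrow> nat ^ 'n \<Rightarrow> real" where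
  "cos_coeff u k =
     (LINT x|lebesgue_on unit_cube. u x * cos_basis k x) /
     (LINT x|lebesgue_on unit_cube. (cos_basis k x)\<^sup>2)"

definition index_norm1 :: "nat ^ 'n \<Rightarrow> nat" where
  "index_norm1 k = (\<Sum>i\<in>UNIV. k $ i)"

text \<open>
  Finiteness of the norm is summability of its nonnegative terms. Since \<open>0 powr 0 = 0\<close>, the weight of
  \<open>k = 0\<close> for \<open>s = 0\<close> is 1 and not 2 as under the convention \<open>0\<^sup>0 = 1\<close>; this single term
  has no influence on membership.
\<close>

definition barron_space :: "real \<Rightarrow> (real ^ 'n \<Rightarrow> real) set" where
  "barron_space s =
     {u. integrable (lebesgue_on unit_cube) u \<and>
         (\<lambda>k. (1 + pi powr s * real (index_norm1 k) powr s) * \<bar>cos_coeff u k\<bar>) summable_on UNIV}"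

subsection \<open>The Sobolev space \<open>H\<^sup>1\<close> of the cube\<close>

definition square_integrable :: "(real ^ 'n \<Rightarrow> 'b :: euclidean_space) \<Rightarrow> bool" where
  "square_integrable f \<longleftrightarrow>
     f \<in> borel_measurable (lebesgue_on unit_cube) \<and>
     integrable (lebesgue_on unit_cube) (\<lambda>x. (norm (f x))\<^sup>2)"

definition partial_deriv :: "'n \<Rightarrow> (real ^ 'n \<Rightarrow> real) \<Rightarrow> real ^ 'n \<Rightarrow> real" where
  "partial_deriv i f x = frechet_derivative f (at x) (axis i 1)"

primrec Ck :: "nat \<Rightarrow> (real ^ 'n \<Rightarrow> real) \<Rightarrow> bool" where
  "Ck 0 f \<longleftrightarrow> continuous_on UNIV f"
| "Ck (Suc m) f \<longleftrightarrow> f differentiable_on UNIV \<and> (\<forall>i. Ck m (partial_deriv i f))"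

text \<open>
  \<open>C\<^sub>c\<^sup>\<infinity>\<close> functions of the open cube, extended by zero to the whole space; the support is
  automatically compact because the cube is bounded.
\<close>

definition test_function :: "(real ^ 'n \<Rightarrow> real) \<Rightarrow> bool" where
  "test_function \<phi> \<longleftrightarrow> (\<forall>m. Ck m \<phi>) \<and> closure {x. \<phi> x \<noteq> 0} \<subseteq> interior unit_cube"

definition has_weak_gradient :: "(real ^ 'n \<Rightarrow> real) \<Rightarrow> (real ^ 'n \<Rightarrow> real ^ 'n) \<Rightarrow> bool" where
  "has_weak_gradient u g \<longleftrightarrow>
     (\<forall>\<phi> i. test_function \<phi> \<longrightarrow>
        (LINT x|lebesgue_on unit_cube. u x * partial_deriv i \<phi> x) =
        - (LINT x|lebesgue_on unit_cube. g x $ i * \<phi> x))"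

text \<open>
  \<open>has_H1_gradient u g\<close>: \<open>u\<close> belongs to \<open>H\<^sup>1\<close> and \<open>\<nabla>u = g\<close>. In the style of
  \<open>has_derivative\<close> this is a relation, since \<open>g\<close> is determined by \<open>u\<close> only almost everywhere.
\<close>

definition has_H1_gradient :: "(real ^ 'n \<Rightarrow> real) \<Rightarrow> (real ^ 'n \<Rightarrow> real ^ 'n) \<Rightarrow> bool" where
  "has_H1_gradient u g \<longleftrightarrow>
     square_integrable u \<and> square_integrable g \<and> has_weak_gradient u g"

subsection \<open>The ground state of \<open>- \<Delta> + V\<close> with Neumann boundary condition\<close>

text \<open>Here \<open>g\<close> stands for the weak gradient of \<open>u\<close>.\<close>

definition rayleigh_quotient ::
    "(real ^ 'n \<Rightarrow> real) \<Rightarrow> (real ^ 'n \<Rightarrow> real) \<Rightarrow> (real ^ 'n \<Rightarrow> real ^ 'n) \<Rightarrow> real" where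
  "rayleigh_quotient V u g =
     (LINT x|lebesgue_on unit_cube. (norm (g x))\<^sup>2 + V x * (u x)\<^sup>2) /
     (LINT x|lebesgue_on unit_cube. (u x)\<^sup>2)"

text \<open>
  A normalised minimiser of the Rayleigh quotient over all nonzero elements of \<open>H\<^sup>1\<close>. The
  Neumann condition is the natural one: no boundary values are imposed on the competitors \<open>w\<close>.
  The sign is left open, so both \<open>u\<close> and \<open>- u\<close> qualify.
\<close>

definition ground_state :: "(real ^ 'n \<Rightarrow> real) \<Rightarrow> (real ^ 'n \<Rightarrow> real) \<Rightarrow> bool" where
  "ground_state V u \<longleftrightarrow>
     (\<exists>g. has_H1_gradient u g \<and>
          (LINT x|lebesgue_on unit_cube. (u x)\<^sup>2) = 1 \<and>
          (\<forall>w h. has_H1_gradient w h \<and> \<not> (AE x in lebesgue_on unit_cube. w x = 0) \<longrightarrow>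
             rayleigh_quotient V u g \<le> rayleigh_quotient V w h))"

end

theory Submission
  imports Defs
begin

text \<open>
  The proof works with the moments \<open>b k = \<integral> u \<Phi>\<^sub>k\<close>, where the cosine modes \<open>\<Phi>\<^sub>k\<close> are indexed by the whole group of integer
  vectors. In these terms the eigenvalue equation becomes an elliptic equation on a lattice, and the theorem is
  a regularity statement for that equation.

  Since \<open>u\<close> minimises the Rayleigh quotient, it satisfies \<open>\<integral> \<nabla>u \<bullet> \<nabla>v + \<integral> V u v = \<mu> \<integral> u v\<close> for smooth \<open>v\<close>
  (\<open>ground_state_weak_equation\<close>). For \<open>v = \<Phi>\<^sub>k\<close> another partial integration turns the first term into \<open>\<pi>\<^sup>2 |k|\<^sup>2 b k\<close>
  (\<open>weak_gradient_against_sin_mode\<close>). Weak gradients are only tested with functions of compact support in the open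
  cube, so this step uses a cutoff; it produces no boundary term because the normal derivative of \<open>\<Phi>\<^sub>k\<close> vanishes on
  the faces. Next, the cosine system is complete (\<open>cos_basis_complete\<close>), so \<open>V\<close> is almost everywhere the sum of its
  absolutely convergent cosine series. As \<open>\<Phi>\<^sub>k \<Phi>\<^sub>m\<close> is the average of the modes \<open>\<Phi>\<close> at the frequencies
  \<open>k \<plusminus> m\<close>, over all choices of signs in the coordinates (\<open>cos_mode_times_basis\<close>), the potential acts as a
  convolution, and
  \<open>\<pi>\<^sup>2 |k|\<^sup>2 \<bar>b k\<bar> \<le> \<bar>\<mu>\<bar> \<bar>b k\<bar> + (\<Sum>j. c j * \<bar>b (k + h j)\<bar>)\<close>.
  Here \<open>V \<in> barron_space s\<close> says that \<open>c\<close> is summable with the weight \<open>(1 + |h|) powr s\<close>.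

  The sequence \<open>b\<close> is bounded, because \<open>u\<close> is integrable. For \<open>|k|\<close> large, dividing by \<open>|k|\<^sup>2\<close> makes the
  convolution a contraction in the sup norm and, with the same constant, in weighted \<open>\<ell>\<^sup>1\<close>; the remaining finitely
  many frequencies are harmless. So the bounded solution \<open>b\<close> of \<open>b \<le> T b + F\<close> is dominated by the limit of the
  iteration in weighted \<open>\<ell>\<^sup>1\<close>, and it belongs to that space (\<open>contraction_bound\<close>, \<open>lattice_elliptic_regularity\<close>). The
  right-hand side of the inequality is then summable with weight \<open>(1 + |k|) powr s\<close>, and the factor \<open>|k|\<^sup>2\<close> on the
  left gives the two additional derivatives.
\<close>

section \<open>Smooth functions of one variable\<close>

text \<open>
  Smoothness is graded by the order so that closure under products can be shown by induction: the
  derivative of a product is a sum of products of functions that are smooth up to one order less.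
\<close>

primrec smooth_upto :: "nat \<Rightarrow> (real \<Rightarrow> real) \<Rightarrow> bool" where
  "smooth_upto 0 f \<longleftrightarrow> True"
| "smooth_upto (Suc m) f \<longleftrightarrow>
     (\<exists>f'. (\<forall>x. (f has_real_derivative f' x) (at x)) \<and> smooth_upto m f')"

definition smooth :: "(real \<Rightarrow> real) \<Rightarrow> bool" where
  "smooth f \<longleftrightarrow> (\<forall>m. smooth_upto m f)"

lemma smooth_upto_SucI:
  "(\<And>x. (f has_real_derivative f' x) (at x)) \<Longrightarrow> smooth_upto m f' \<Longrightarrow> smooth_upto (Suc m) f"
  by auto

lemma smooth_upto_Suc_D: "smooth_upto (Suc m) f \<Longrightarrow> smooth_upto m f"
proof (induction m arbitrary: f)
  case (Suc m)
  then show ?case by (metis smooth_upto.simps(2))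
qed simp

lemma smooth_upto_const: "smooth_upto m (\<lambda>x. c)"
proof (induction m arbitrary: c)
  case (Suc m)
  then show ?case by (auto intro!: exI[of _ "\<lambda>x. 0"])
qed simp

lemma smooth_upto_add:
  "smooth_upto m f \<Longrightarrow> smooth_upto m g \<Longrightarrow> smooth_upto m (\<lambda>x. f x + g x)"
proof (induction m arbitrary: f g)
  case (Suc m)
  then obtain f' g' where
    "\<And>x. (f has_real_derivative f' x) (at x)" "smooth_upto m f'"
    "\<And>x. (g has_real_derivative g' x) (at x)" "smooth_upto m g'"
    by auto
  then show ?case
    using Suc.IH by (auto intro!: exI[of _ "\<lambda>x. f' x + g' x"] derivative_eq_intros)
qed simp

lemma smooth_upto_mult:
  "smooth_upto m f \<Longrightarrow> smooth_upto m g \<Longrightarrow> smooth_upto m (\<lambda>x. f x * g x)"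
proof (induction m arbitrary: f g)
  case (Suc m)
  then obtain f' g' where fg:
    "\<And>x. (f has_real_derivative f' x) (at x)" "smooth_upto m f'"
    "\<And>x. (g has_real_derivative g' x) (at x)" "smooth_upto m g'"
    by auto
  have "smooth_upto m (\<lambda>x. f' x * g x + f x * g' x)"
    using fg smooth_upto_Suc_D[OF Suc.prems(1)] smooth_upto_Suc_D[OF Suc.prems(2)]
    by (intro smooth_upto_add Suc.IH)
  moreover have "((\<lambda>x. f x * g x) has_real_derivative (f' x * g x + f x * g' x)) (at x)" for x
    using fg(1)[of x] fg(3)[of x] by (auto intro!: derivative_eq_intros)
  ultimately show ?case by (rule smooth_upto_SucI[rotated])
qed simp

lemma smooth_upto_affine:
  "smooth_upto m f \<Longrightarrow> smooth_upto m (\<lambda>x. f (a * x + b))"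
proof (induction m arbitrary: f)
  case (Suc m)
  then obtain f' where f:
    "\<And>x. (f has_real_derivative f' x) (at x)" "smooth_upto m f'"
    by auto
  have "smooth_upto m (\<lambda>x. a * f' (a * x + b))"
    using Suc.IH[OF f(2)] by (intro smooth_upto_mult smooth_upto_const)
  moreover have "((\<lambda>x. f (a * x + b)) has_real_derivative a * f' (a * x + b)) (at x)" for x
  proof -
    have "((\<lambda>x. a * x + b) has_real_derivative a) (at x)"
      by (auto intro!: derivative_eq_intros)
    from DERIV_chain2[OF f(1) this] show ?thesis by (simp add: mult.commute)
  qed
  ultimately show ?case by (rule smooth_upto_SucI[rotated])
qed simp

lemma smooth_mult: "smooth f \<Longrightarrow> smooth g \<Longrightarrow> smooth (\<lambda>x. f x * g x)"
  by (simp add: smooth_def smooth_upto_mult)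

lemma smooth_affine: "smooth f \<Longrightarrow> smooth (\<lambda>x. f (a * x + b))"
  by (simp add: smooth_def smooth_upto_affine)

lemma smooth_sin_cos: "smooth sin" "smooth cos"
proof -
  have "smooth_upto m sin \<and> smooth_upto m cos" for m
  proof (induction m)
    case (Suc m)
    have "smooth_upto m (\<lambda>x. (-1) * sin x)"
      using Suc by (intro smooth_upto_mult smooth_upto_const) auto
    then have "\<exists>f'. (\<forall>x. (cos has_real_derivative f' x) (at x)) \<and> smooth_upto m f'"
      by (intro exI[of _ "\<lambda>x. (-1) * sin x"]) (auto intro!: derivative_eq_intros)
    moreover have "\<exists>f'. (\<forall>x. (sin has_real_derivative f' x) (at x)) \<and> smooth_upto m f'"
      using Suc by (intro exI[of _ cos]) (auto intro!: derivative_eq_intros)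
    ultimately show ?case by simp
  qed simp
  then show "smooth sin" "smooth cos" by (auto simp: smooth_def)
qed

lemma smooth_derivative:
  assumes "smooth f" and "\<And>x. (f has_real_derivative f' x) (at x)"
  shows "smooth f'"
  unfolding smooth_def
proof
  fix m
  have "smooth_upto (Suc m) f" using assms(1) by (simp add: smooth_def)
  then obtain g where "\<And>x. (f has_real_derivative g x) (at x)" "smooth_upto m g" by auto
  moreover from this have "g = f'" using assms(2) DERIV_unique by blast
  ultimately show "smooth_upto m f'" by simp
qed

lemma smooth_deriv:
  assumes "smooth f" shows "(f has_real_derivative deriv f x) (at x)"
proof -
  have "smooth_upto (Suc 0) f" using assms by (simp add: smooth_def)
  then show ?thesis by (metis DERIV_imp_deriv smooth_upto.simps(2))
qed

text \<open>
  The family is closed under differentiation up to linear combinations, so that smoothness of all its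
  members follows by one induction. At the origin, the difference quotient of \<open>flat_exp n\<close> is
  \<open>flat_exp (n + 1)\<close>.
\<close>

definition flat_exp :: "nat \<Rightarrow> real \<Rightarrow> real" where
  "flat_exp n x = (if x \<le> 0 then 0 else exp (- (1 / x)) / x ^ n)"

text \<open>
  Substituting \<open>y = 1 / x\<close>, the upper bound says \<open>y ^ n \<le> fact n * exp y\<close>, which compares the
  exponential series with one of its terms.
\<close>

lemma flat_exp_bounds: "0 \<le> flat_exp n x" "flat_exp n x \<le> fact n"
proof -
  show "0 \<le> flat_exp n x" by (simp add: flat_exp_def)
  have "inverse x ^ n / fact n \<le> exp (inverse x)" if "x > 0"
    using that sum_le_suminf[OF summable_exp_generic[of "inverse x"], of "{n}"]
    by (simp add: exp_def divide_inverse mult.commute)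
  then show "flat_exp n x \<le> fact n"
    by (auto simp: flat_exp_def exp_minus field_simps)
qed

lemma flat_exp_tendsto_0: "(flat_exp n \<longlongrightarrow> 0) (at 0)"
proof -
  have "((\<lambda>x::real. x ^ n / exp x) \<longlongrightarrow> 0) at_top" by (rule tendsto_power_div_exp_0)
  then have "((\<lambda>x. (inverse x) ^ n / exp (inverse x)) \<longlongrightarrow> 0) (at_right (0::real))"
    by (rule filterlim_compose[OF _ filterlim_inverse_at_top_right])
  moreover have "\<forall>\<^sub>F x in at_right 0. (inverse x) ^ n / exp (inverse x) = flat_exp n x"
    by (auto simp: eventually_at_right_less flat_exp_def exp_minus field_simps
        intro!: eventually_mono[OF eventually_at_right_less[of 0]])
  ultimately have R: "(flat_exp n \<longlongrightarrow> 0) (at_right 0)" by (blast intro: Lim_transform_eventually)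
  have "\<forall>\<^sub>F x in at_left 0. 0 = flat_exp n x"
    by (auto simp: flat_exp_def eventually_at_filter)
  then have "(flat_exp n \<longlongrightarrow> 0) (at_left 0)"
    by (rule Lim_transform_eventually[OF tendsto_const])
  with R show ?thesis by (simp add: filterlim_split_at)
qed

lemma flat_exp_deriv:
  "(flat_exp n has_real_derivative flat_exp (n + 2) x - real n * flat_exp (n + 1) x) (at x)"
proof (cases x "0 :: real" rule: linorder_cases)
  case less
  have "(flat_exp n has_real_derivative 0) (at x)"
    by (rule has_field_derivative_transform_within_open[of "\<lambda>x. 0" _ _ "{..<0}"])
      (use less in \<open>auto simp: flat_exp_def\<close>)
  then show ?thesis using less by (simp add: flat_exp_def)
next
  case equal
  have "((\<lambda>h. (flat_exp n (0 + h) - flat_exp n 0) / h) \<longlongrightarrow> 0) (at 0)"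
    using flat_exp_tendsto_0[of "Suc n"]
    by (rule Lim_transform_eventually) (auto simp: flat_exp_def eventually_at_filter field_simps)
  then show ?thesis using equal by (simp add: DERIV_def flat_exp_def)
next
  case greater
  have "((\<lambda>x. exp (- (1 / x)) / x ^ n) has_real_derivative
      flat_exp (n + 2) x - real n * flat_exp (n + 1) x) (at x)"
    using greater
    apply (auto intro!: derivative_eq_intros simp: flat_exp_def field_simps power2_eq_square)
    by (cases n) (auto simp: field_simps)
  then show ?thesis
    by (rule has_field_derivative_transform_within_open[of _ _ _ "{0<..}"])
      (use greater in \<open>auto simp: flat_exp_def\<close>)
qed

lemma smooth_flat_exp: "smooth (flat_exp n)"
  unfolding smooth_def
proof
  fix m show "smooth_upto m (flat_exp n)"
  proof (induction m arbitrary: n)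
    case (Suc m)
    have "smooth_upto m (\<lambda>x. flat_exp (n + 2) x + (- real n) * flat_exp (n + 1) x)"
      using Suc by (intro smooth_upto_add smooth_upto_mult smooth_upto_const) auto
    then show ?case using flat_exp_deriv[of n] by (intro smooth_upto_SucI) auto
  qed simp
qed

lemma flat_exp_tendsto_at_top:
  "(flat_exp n \<longlongrightarrow> (if n = 0 then 1 else 0)) at_top"
proof -
  have inv: "((\<lambda>x::real. inverse x) \<longlongrightarrow> 0) at_top"
    by (rule tendsto_inverse_0_at_top[OF filterlim_ident])
  have "((\<lambda>x::real. exp (- inverse x) * inverse x ^ n) \<longlongrightarrow> exp (- 0) * 0 ^ n) at_top"
    by (intro tendsto_intros inv)
  then have "((\<lambda>x::real. exp (- inverse x) * inverse x ^ n) \<longlongrightarrow> (if n = 0 then 1 else 0)) at_top"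
    by (auto simp: power_0_left split: if_splits)
  then show ?thesis
    by (rule Lim_transform_eventually)
      (auto simp: flat_exp_def divide_inverse power_inverse
        intro!: eventually_mono[OF eventually_gt_at_top[of 0]])
qed

section \<open>Tensor products as test functions\<close>

text \<open>
  Functions of this form are stable under partial derivatives, and both the cosine basis and its
  localisations by a cutoff in every variable belong to them.
\<close>

definition tensor :: "('n :: finite \<Rightarrow> real \<Rightarrow> real) \<Rightarrow> real ^ 'n \<Rightarrow> real" where
  "tensor f x = (\<Prod>i\<in>UNIV. f i (x $ i))"

lemma tensor_upd: "tensor (f(i := g)) x = g (x $ i) * (\<Prod>j\<in>UNIV - {i}. f j (x $ j))"
  by (simp add: tensor_def prod.remove[of UNIV i])

lemma tensor_has_derivative:
  assumes "\<And>i. (f i has_real_derivative f' i (x $ i)) (at (x $ i))"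
  shows "(tensor f has_derivative (\<lambda>v. \<Sum>i\<in>UNIV. v $ i * tensor (f(i := f' i)) x)) (at x)"
proof -
  have "((\<lambda>x. f i (x $ i)) has_derivative (\<lambda>v. f' i (x $ i) * v $ i)) (at x)" for i
    using has_derivative_compose[OF bounded_linear_imp_has_derivative[OF bounded_linear_vec_nth]
        assms[of i, unfolded has_field_derivative_def]]
    by simp
  then have "((\<lambda>x. \<Prod>i\<in>UNIV. f i (x $ i)) has_derivative
      (\<lambda>v. \<Sum>i\<in>UNIV. f' i (x $ i) * v $ i * (\<Prod>j\<in>UNIV - {i}. f j (x $ j)))) (at x)"
    by (intro has_derivative_prod)
  then show ?thesis
    unfolding tensor_upd by (simp add: mult_ac tensor_def[abs_def])
qed

lemma partial_deriv_tensor: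
  assumes "\<And>i. (f i has_real_derivative f' i (x $ i)) (at (x $ i))"
  shows "partial_deriv i (tensor f) x = tensor (f(i := f' i)) x"
  unfolding partial_deriv_def frechet_derivative_at[OF tensor_has_derivative[of f f' x], OF assms, symmetric]
  by (simp add: axis_def if_distrib[of "\<lambda>y. y * _"] cong: if_cong)

lemma continuous_on_tensor:
  assumes "\<And>i. continuous_on UNIV (f i)" shows "continuous_on A (tensor f)"
  unfolding tensor_def
  by (intro continuous_intros continuous_on_compose2[OF assms]) auto

lemma smooth_continuous: "smooth f \<Longrightarrow> continuous_on A f"
  by (meson DERIV_isCont continuous_at_imp_continuous_on smooth_deriv)

lemma Ck_tensor:
  assumes "\<And>i. smooth (f i)" shows "Ck m (tensor f)"
  using assms
proof (induction m arbitrary: f)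
  case 0
  then show ?case by (simp add: continuous_on_tensor smooth_continuous)
next
  case (Suc m)
  have pd: "partial_deriv i (tensor f) = tensor (f(i := deriv (f i)))" for i
    by (rule ext) (simp add: partial_deriv_tensor[of f "\<lambda>i. deriv (f i)"] smooth_deriv Suc.prems)
  have "tensor f differentiable at x" for x
    using tensor_has_derivative[of f "\<lambda>i. deriv (f i)" x] Suc.prems smooth_deriv
    by (auto simp: differentiable_def)
  then have "tensor f differentiable_on UNIV"
    by (simp add: differentiable_on_def)
  moreover have "Ck m (partial_deriv i (tensor f))" for i
    unfolding pd using Suc.prems smooth_derivative[OF Suc.prems smooth_deriv[OF Suc.prems]]
    by (intro Suc.IH) auto
  ultimately show ?case by simp
qed

lemma test_function_tensor:
  fixes f :: "'n :: finite \<Rightarrow> real \<Rightarrow> real"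
  assumes "\<And>i. smooth (f i)" and "\<epsilon> > 0"
    and "\<And>i t. t \<notin> {\<epsilon>..1 - \<epsilon>} \<Longrightarrow> f i t = 0"
  shows "test_function (tensor f)"
proof -
  have "{x. tensor f x \<noteq> 0} \<subseteq> cbox (\<chi> i. \<epsilon>) (\<chi> i. 1 - \<epsilon>)"
    using assms(3) by (fastforce simp: tensor_def mem_box_cart)
  then have "closure {x. tensor f x \<noteq> 0} \<subseteq> cbox (\<chi> i. \<epsilon>) (\<chi> i. 1 - \<epsilon>)"
    by (rule closure_minimal) (rule closed_cbox)
  also have "\<dots> \<subseteq> box 0 1"
    using \<open>\<epsilon> > 0\<close> by (auto simp: mem_box_cart) (smt (verit) )+
  finally show ?thesis
    using Ck_tensor[of f, OF assms(1)] by (simp add: test_function_def interior_cbox)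
qed

section \<open>A cutoff with controlled boundary layers\<close>

text \<open>
  For large \<open>N\<close> this smooth function is supported in \<open>{1 / N..1 - 1 / N}\<close> and increases to 1 on the open
  interval.
\<close>

definition cutoff :: "real \<Rightarrow> real \<Rightarrow> real" where
  "cutoff N t = flat_exp 0 (N * t - 1) * flat_exp 0 (N * (1 - t) - 1)"

definition cutoff' :: "real \<Rightarrow> real \<Rightarrow> real" where
  "cutoff' N t = N * flat_exp 2 (N * t - 1) * flat_exp 0 (N * (1 - t) - 1)
               - N * flat_exp 0 (N * t - 1) * flat_exp 2 (N * (1 - t) - 1)"

lemma cutoff_deriv: "(cutoff N has_real_derivative cutoff' N t) (at t)"
proof -
  have F: "(flat_exp 0 has_real_derivative flat_exp 2 x) (at x)" for x
    using flat_exp_deriv[of 0 x] by (simp add: numeral_2_eq_2)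
  have "((\<lambda>t. flat_exp 0 (N * t - 1)) has_real_derivative flat_exp 2 (N * t - 1) * N) (at t)"
    by (rule DERIV_chain2[OF F]) (auto intro!: derivative_eq_intros)
  moreover have "((\<lambda>t. flat_exp 0 (N * (1 - t) - 1)) has_real_derivative
      flat_exp 2 (N * (1 - t) - 1) * (- N)) (at t)"
    by (rule DERIV_chain2[OF F]) (auto intro!: derivative_eq_intros)
  ultimately show ?thesis
    unfolding cutoff_def[abs_def] cutoff'_def
    by (rule DERIV_mult[THEN DERIV_cong]) (simp add: algebra_simps)
qed

lemma smooth_cutoff: "smooth (cutoff N)"
proof -
  have "smooth (\<lambda>t. flat_exp 0 (N * t + (- 1)) * flat_exp 0 ((- N) * t + (N - 1)))"
    by (intro smooth_mult smooth_affine smooth_flat_exp)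
  also have "(\<lambda>t. flat_exp 0 (N * t + (- 1)) * flat_exp 0 ((- N) * t + (N - 1))) = cutoff N"
    by (auto simp: cutoff_def[abs_def] algebra_simps)
  finally show ?thesis .
qed

lemma cutoff_bounds: "0 \<le> cutoff N t" "cutoff N t \<le> 1"
  using flat_exp_bounds[of 0] by (auto simp: cutoff_def intro!: mult_le_one)

lemma cutoff_eq_0:
  assumes "N > 0" "t \<notin> {1 / N..1 - 1 / N}" shows "cutoff N t = 0"
proof -
  have "t < 1 / N \<or> 1 - t < 1 / N" using assms by auto
  then have "N * t - 1 \<le> 0 \<or> N * (1 - t) - 1 \<le> 0"
    using \<open>N > 0\<close> by (auto simp: field_simps)
  then show ?thesis by (auto simp: cutoff_def flat_exp_def)
qed

lemma scaled_at_top: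
  assumes "t > 0" shows "filterlim (\<lambda>N. real N * t - 1) at_top sequentially"
  using filterlim_tendsto_add_at_top[OF tendsto_const[of "-1"]
      filterlim_at_top_mult_tendsto_pos[OF tendsto_const[of t] assms filterlim_real_sequentially]]
  by (simp add: algebra_simps)

lemma cutoff_tendsto:
  assumes "0 < t" "t < 1" shows "(\<lambda>N. cutoff (real N) t) \<longlonglongrightarrow> 1"
proof -
  have "(\<lambda>N. flat_exp 0 (real N * t - 1) * flat_exp 0 (real N * (1 - t) - 1)) \<longlonglongrightarrow> 1 * 1"
    by (intro tendsto_mult filterlim_compose[OF flat_exp_tendsto_at_top[of 0, simplified]]
        scaled_at_top) (use assms in auto)
  then show ?thesis by (simp add: cutoff_def)
qed

text \<open>
  Up to a factor in \<open>{0..1}\<close>, this is the part of \<open>cutoff' N t\<close> that lives near \<open>t = 0\<close>, multiplied by the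
  distance \<open>t\<close> to that end point (see \<open>layer_eq\<close>). Although \<open>cutoff'\<close> is of size \<open>N\<close>, the product stays
  bounded uniformly in \<open>N\<close>, and for fixed \<open>t > 0\<close> it tends to 0.
\<close>

definition layer :: "real \<Rightarrow> real \<Rightarrow> real" where
  "layer N t = flat_exp 1 (N * t - 1) + flat_exp 2 (N * t - 1)"

lemma layer_eq: "N * t * flat_exp 2 (N * t - 1) = layer N t"
proof -
  \<comment> \<open>With \<open>y = N * t - 1\<close>, the claim is \<open>(y + 1) / y\<^sup>2 = 1 / y + 1 / y\<^sup>2\<close>.\<close>
  define y where "y = N * t - 1"
  then have "N * t = y + 1" by simp
  then show ?thesis
    unfolding layer_def y_def[symmetric]
    by (auto simp: flat_exp_def field_simps power2_eq_square)
qed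

lemma layer_bounds: "0 \<le> layer N t" "layer N t \<le> 3"
  using flat_exp_bounds[of 1 "N * t - 1"] flat_exp_bounds[of 2 "N * t - 1"]
  by (auto simp: layer_def fact_numeral numeral_2_eq_2)

lemma layer_tendsto:
  assumes "0 < t" shows "(\<lambda>N. layer (real N) t) \<longlonglongrightarrow> 0"
proof -
  have "(\<lambda>N. flat_exp 1 (real N * t - 1) + flat_exp 2 (real N * t - 1)) \<longlonglongrightarrow> 0 + 0"
    using flat_exp_tendsto_at_top[of 1] flat_exp_tendsto_at_top[of 2]
    by (intro tendsto_add filterlim_compose[OF _ scaled_at_top[OF assms]]) auto
  then show ?thesis by (simp add: layer_def)
qed

text \<open>
  The sine vanishes at both end points of the unit interval, because the frequency is an integer multiple of
  \<open>\<pi>\<close>.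
\<close>

lemma abs_sin_int_le:
  "\<bar>sin (pi * of_int k * t)\<bar> \<le> pi * \<bar>of_int k\<bar> * \<bar>t\<bar>"
  "\<bar>sin (pi * of_int k * t)\<bar> \<le> pi * \<bar>of_int k\<bar> * \<bar>1 - t\<bar>"
proof -
  have A: "\<bar>sin (pi * of_int k * s)\<bar> \<le> pi * \<bar>of_int k\<bar> * \<bar>s\<bar>" for s :: real
    using abs_sin_x_le_abs_x[of "pi * of_int k * s"] by (simp add: abs_mult)
  show "\<bar>sin (pi * of_int k * t)\<bar> \<le> pi * \<bar>of_int k\<bar> * \<bar>t\<bar>" by (rule A)
  have "sin (pi * of_int k * t) = sin (pi * of_int k - pi * of_int k * (1 - t))"
    by (simp add: algebra_simps)
  also have "\<dots> = - (cos (pi * of_int k) * sin (pi * of_int k * (1 - t)))"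
    using sin_zero_iff_int2[of "pi * of_int k"] by (simp add: sin_diff)
  finally have "\<bar>sin (pi * of_int k * t)\<bar> \<le> \<bar>sin (pi * of_int k * (1 - t))\<bar>"
    using abs_cos_le_one[of "pi * of_int k"] by (simp add: abs_mult mult_left_le_one_le)
  with A[of "1 - t"] show "\<bar>sin (pi * of_int k * t)\<bar> \<le> pi * \<bar>of_int k\<bar> * \<bar>1 - t\<bar>"
    by linarith
qed

text \<open>
  The zeros of the sine at the end points pay for the large derivative of the cutoff there. This is the
  only place where the homogeneous Neumann condition of the cosine modes enters.
\<close>

lemma sin_cutoff'_le:
  assumes "0 \<le> t" "t \<le> 1" "0 \<le> N"
  shows "\<bar>sin (pi * of_int k * t) * cutoff' N t\<bar> \<le> pi * \<bar>of_int k\<bar> * (layer N t + layer N (1 - t))"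
proof -
  let ?s = "\<bar>sin (pi * of_int k * t)\<bar>" and ?c = "pi * \<bar>real_of_int k\<bar>"
  note b = flat_exp_bounds[of 0, simplified] flat_exp_bounds(1)[of 2]
  have "?s * \<bar>N * flat_exp 2 (N * t - 1) * flat_exp 0 (N * (1 - t) - 1)\<bar>
      \<le> (?c * t) * (N * flat_exp 2 (N * t - 1))"
    using abs_sin_int_le(1)[of k t] assms b by (intro mult_mono) (auto simp: abs_mult mult_left_le)
  moreover have "?s * \<bar>N * flat_exp 0 (N * t - 1) * flat_exp 2 (N * (1 - t) - 1)\<bar>
      \<le> (?c * (1 - t)) * (N * flat_exp 2 (N * (1 - t) - 1))"
    using abs_sin_int_le(2)[of k t] assms b
    by (intro mult_mono) (auto simp: abs_mult intro!: mult_right_mono mult_left_le)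
  moreover have "\<bar>sin (pi * of_int k * t) * cutoff' N t\<bar> \<le>
      ?s * \<bar>N * flat_exp 2 (N * t - 1) * flat_exp 0 (N * (1 - t) - 1)\<bar> +
      ?s * \<bar>N * flat_exp 0 (N * t - 1) * flat_exp 2 (N * (1 - t) - 1)\<bar>"
    unfolding abs_mult distrib_left[symmetric] cutoff'_def
    by (intro mult_left_mono) (auto simp flip: abs_mult)
  ultimately have "\<bar>sin (pi * of_int k * t) * cutoff' N t\<bar> \<le>
      ?c * (N * t * flat_exp 2 (N * t - 1)) + ?c * (N * (1 - t) * flat_exp 2 (N * (1 - t) - 1))"
    by (simp add: mult_ac)
  then show ?thesis unfolding layer_eq by (simp add: distrib_left)
qed

section \<open>Integration over the cube\<close>

abbreviation cube_measure :: "(real ^ 'n) measure" where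
  "cube_measure \<equiv> lebesgue_on unit_cube"

lemma finite_measure_cube: "finite_measure cube_measure"
  by (rule finite_measureI)
    (use emeasure_lborel_cbox_finite[of 0 1] in \<open>simp add: emeasure_restrict_space top.not_eq_extremum\<close>)

lemma AE_cube_interior: "AE x :: real ^ 'n in cube_measure. x \<in> box 0 1"
proof -
  have "cbox 0 1 - box 0 (1 :: real ^ 'n) \<in> null_sets lebesgue"
    using negligible_frontier_interval negligible_iff_null_sets by blast
  then have "AE x :: real ^ 'n in lebesgue. x \<in> cbox 0 1 \<longrightarrow> x \<in> box 0 1"
    by (rule AE_I') auto
  then show ?thesis by (simp add: AE_restrict_space_iff)
qed

lemma continuous_cube_measurable:
  "continuous_on UNIV f \<Longrightarrow> f \<in> borel_measurable cube_measure"
  by (intro continuous_imp_measurable_on_sets_lebesgue) (auto intro: continuous_on_subset)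

lemma integrable_mult_bounded:
  fixes u f :: "'a \<Rightarrow> real"
  assumes u: "integrable M u" and f: "f \<in> borel_measurable M"
    and b: "\<And>x. x \<in> space M \<Longrightarrow> \<bar>f x\<bar> \<le> B"
  shows "integrable M (\<lambda>x. u x * f x)"
proof (rule Bochner_Integration.integrable_bound)
  show "integrable M (\<lambda>x. B * u x)" using u by simp
  show "(\<lambda>x. u x * f x) \<in> borel_measurable M" using u f by auto
  show "AE x in M. norm (u x * f x) \<le> norm (B * u x)"
  proof (rule AE_I2)
    fix x assume "x \<in> space M"
    then have "\<bar>u x\<bar> * \<bar>f x\<bar> \<le> \<bar>u x\<bar> * \<bar>B\<bar>" using b by (intro mult_left_mono) force+
    then show "norm (u x * f x) \<le> norm (B * u x)" by (simp add: abs_mult mult.commute)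
  qed
qed

lemma continuous_bounded_cube:
  fixes f :: "real ^ 'n \<Rightarrow> real"
  assumes "continuous_on UNIV f"
  obtains B where "B > 0" "\<And>x. x \<in> unit_cube \<Longrightarrow> \<bar>f x\<bar> \<le> B"
proof -
  have "bounded (f ` unit_cube)"
    by (intro compact_imp_bounded compact_continuous_image compact_cbox)
      (use assms continuous_on_subset in blast)
  then show ?thesis using that by (auto simp: bounded_pos)
qed

lemma integrable_mult_continuous:
  fixes u f :: "real ^ 'n \<Rightarrow> real"
  assumes "integrable cube_measure u" "continuous_on UNIV f"
  shows "integrable cube_measure (\<lambda>x. u x * f x)"
proof -
  obtain B where "\<And>x. x \<in> unit_cube \<Longrightarrow> \<bar>f x\<bar> \<le> B"
    using continuous_bounded_cube[OF assms(2)] by metis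
  then show ?thesis
    by (intro integrable_mult_bounded[OF assms(1) continuous_cube_measurable[OF assms(2)], of B]) auto
qed

lemma integrable_continuous_cube:
  fixes f :: "real ^ 'n \<Rightarrow> real"
  assumes "continuous_on UNIV f" shows "integrable cube_measure f"
proof -
  have "integrable cube_measure (\<lambda>x :: real ^ 'n. 1 :: real)"
    using finite_measure.integrable_const[OF finite_measure_cube] .
  from integrable_mult_continuous[OF this assms] show ?thesis by simp
qed

section \<open>Partial integration against sine modes\<close>

text \<open>
  The cosine basis is extended to frequencies in the group \<open>int ^ 'n\<close>, where it is even in each coordinate.
  Products of modes then become sums over translated frequencies, and translations are bijections.
\<close>

definition cos_mode :: "int ^ 'n \<Rightarrow> real ^ 'n \<Rightarrow> real" where
  "cos_mode k = tensor (\<lambda>j t. cos (pi * of_int (k $ j) * t))"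

definition sin_mode :: "'n \<Rightarrow> int ^ 'n \<Rightarrow> real ^ 'n \<Rightarrow> real" where
  "sin_mode i k = tensor ((\<lambda>j t. cos (pi * of_int (k $ j) * t))(i := \<lambda>t. sin (pi * of_int (k $ i) * t)))"

lemma continuous_modes: "continuous_on A (cos_mode k)" "continuous_on A (sin_mode i k)"
  unfolding cos_mode_def sin_mode_def
  by (auto intro!: continuous_on_tensor continuous_intros)

lemma cos_mode_bound: "\<bar>cos_mode k x\<bar> \<le> 1"
  unfolding cos_mode_def tensor_def abs_prod by (rule prod_le_1) auto

lemma cos_mode_has_derivative:
  "(cos_mode k has_derivative (\<lambda>v. \<Sum>i\<in>UNIV. v $ i * (- (pi * of_int (k $ i)) * sin_mode i k x))) (at x)"
proof -
  have "(cos_mode k has_derivative (\<lambda>v. \<Sum>i\<in>UNIV. v $ i *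
      tensor ((\<lambda>j t. cos (pi * of_int (k $ j) * t))
        (i := (\<lambda>t. - (pi * of_int (k $ i)) * sin (pi * of_int (k $ i) * t)))) x)) (at x)"
    unfolding cos_mode_def
    by (rule tensor_has_derivative) (auto intro!: derivative_eq_intros)
  then show ?thesis by (simp add: sin_mode_def tensor_upd mult_ac)
qed

text \<open>
  Integration by parts against \<open>sin_mode i k\<close>, which is smooth but not compactly supported in the open
  cube. It vanishes on the two faces orthogonal to the \<open>i\<close>-th axis, and only these matter for the \<open>i\<close>-th
  partial derivative. So the function is multiplied by a cutoff in each variable, which makes it a test
  function; the term in which the derivative hits the cutoff is bounded and tends to 0 by
  \<open>sin_cutoff'_le\<close>, and dominated convergence gives the claim.
\<close>

lemma weak_gradient_against_sin_mode:
  fixes u :: "real ^ 'n \<Rightarrow> real"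
  assumes wg: "has_weak_gradient u g" and u: "integrable cube_measure u"
    and g: "integrable cube_measure (\<lambda>x. g x $ i)"
  shows "(LINT x|cube_measure. g x $ i * sin_mode i k x) =
         - (pi * of_int (k $ i)) * (LINT x|cube_measure. u x * cos_mode k x)"
proof -
  let ?c = "\<lambda>j t. cos (pi * of_int (k $ j) * t)" and ?s = "\<lambda>t. sin (pi * of_int (k $ i) * t)"
  let ?p = "pi * real_of_int (k $ i)"
  \<comment> \<open>The shift by one keeps the cutoff parameter positive.\<close>
  define N where "N n = real (Suc n)" for n
  define f where "f n = (\<lambda>j t. ?c j t * cutoff (N n) t)(i := \<lambda>t. ?s t * cutoff (N n) t)" for n
  define f' where "f' n t = ?p * ?c i t * cutoff (N n) t + ?s t * cutoff' (N n) t" for n t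
  have N: "N n > 0" for n by (simp add: N_def)
  have sm: "smooth (f n j)" for n j
    using smooth_affine[OF smooth_sin_cos(1), of "pi * of_int (k $ j)" 0]
      smooth_affine[OF smooth_sin_cos(2), of "pi * of_int (k $ j)" 0]
    by (auto simp: f_def intro!: smooth_mult smooth_cutoff)
  have test: "test_function (tensor (f n))" for n
    by (rule test_function_tensor[of _ "1 / N n"])
      (use sm N in \<open>auto simp: f_def cutoff_eq_0\<close>)
  have der: "(f n i has_real_derivative f' n t) (at t)" for n t
    unfolding f_def f'_def by (auto intro!: derivative_eq_intros cutoff_deriv)
  have "partial_deriv i (tensor (f n)) x =
      tensor ((f n)(i := ((\<lambda>j. deriv (f n j))(i := f' n)) i)) x" for n x
    by (rule partial_deriv_tensor) (auto intro: smooth_deriv sm der)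
  then have pd: "partial_deriv i (tensor (f n)) = tensor ((f n)(i := f' n))" for n
    by auto
  have "(LINT x|cube_measure. u x * tensor ((f n)(i := f' n)) x) =
      - (LINT x|cube_measure. g x $ i * tensor (f n) x)" for n
    using wg[unfolded has_weak_gradient_def, rule_format, OF test[of n], of i] unfolding pd .
  moreover have "(\<lambda>n. LINT x|cube_measure. u x * tensor ((f n)(i := f' n)) x) \<longlonglongrightarrow>
      (LINT x|cube_measure. u x * (?p * cos_mode k x))"
  proof (rule integral_dominated_convergence[where w = "\<lambda>x. (7 * \<bar>?p\<bar>) * \<bar>u x\<bar>"])
    have cf': "continuous_on UNIV (f' n)" for n
      by (rule smooth_continuous[OF smooth_derivative[OF sm[of n i] der]])
    show "(\<lambda>x. u x * (?p * cos_mode k x)) \<in> borel_measurable cube_measure"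
      using u continuous_cube_measurable[OF continuous_modes(1)[of _ k]] by auto
    show "(\<lambda>x. u x * tensor ((f n)(i := f' n)) x) \<in> borel_measurable cube_measure" for n
      by (intro borel_measurable_times[OF borel_measurable_integrable[OF u]]
          continuous_cube_measurable continuous_on_tensor) (auto simp: smooth_continuous sm cf')
    show "integrable cube_measure (\<lambda>x. (7 * \<bar>?p\<bar>) * \<bar>u x\<bar>)" using u by simp
    show "AE x in cube_measure. (\<lambda>n. u x * tensor ((f n)(i := f' n)) x) \<longlonglongrightarrow> u x * (?p * cos_mode k x)"
      using AE_cube_interior
    proof eventually_elim
      case (elim x)
      then have x: "0 < x $ j" "x $ j < 1" for j by (auto simp: mem_box_cart)
      have c1: "(\<lambda>n. cutoff (N n) (x $ j)) \<longlonglongrightarrow> 1" for j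
        unfolding N_def by (rule LIMSEQ_Suc[OF cutoff_tendsto[OF x]])
      have l: "(\<lambda>n. layer (N n) (x $ i)) \<longlonglongrightarrow> 0" "(\<lambda>n. layer (N n) (1 - x $ i)) \<longlonglongrightarrow> 0"
        unfolding N_def by (rule LIMSEQ_Suc[OF layer_tendsto], use x in simp)+
      \<comment> \<open>The contribution of the boundary layers disappears in the limit.\<close>
      have "(\<lambda>n. ?s (x $ i) * cutoff' (N n) (x $ i)) \<longlonglongrightarrow> 0"
      proof (rule Lim_null_comparison)
        show "\<forall>\<^sub>F n in sequentially. norm (?s (x $ i) * cutoff' (N n) (x $ i))
            \<le> pi * \<bar>of_int (k $ i)\<bar> * (layer (N n) (x $ i) + layer (N n) (1 - x $ i))"
          using sin_cutoff'_le[of "x $ i" _ "k $ i"] x[of i] N by (auto simp: less_imp_le)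
        show "(\<lambda>n. pi * \<bar>of_int (k $ i)\<bar> * (layer (N n) (x $ i) + layer (N n) (1 - x $ i))) \<longlonglongrightarrow> 0"
          by (rule tendsto_eq_intros l refl | simp)+
      qed
      then have "(\<lambda>n. f' n (x $ i)) \<longlonglongrightarrow> ?p * ?c i (x $ i) * 1 + 0"
        unfolding f'_def by (intro tendsto_intros c1)
      then have "(\<lambda>n. tensor ((f n)(i := f' n)) x) \<longlonglongrightarrow>
          ?p * ?c i (x $ i) * 1 * (\<Prod>j\<in>UNIV - {i}. ?c j (x $ j) * 1)"
        unfolding tensor_upd
        by (auto intro!: tendsto_mult tendsto_prod c1 tendsto_const simp: f_def
            simp del: mult_1_right)
      also have "?p * ?c i (x $ i) * 1 * (\<Prod>j\<in>UNIV - {i}. ?c j (x $ j) * 1) = ?p * cos_mode k x"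
        by (simp add: cos_mode_def tensor_def prod.remove[of UNIV i])
      finally show ?case by (intro tendsto_mult tendsto_const)
    qed
    show "AE x in cube_measure. norm (u x * tensor ((f n)(i := f' n)) x) \<le> (7 * \<bar>?p\<bar>) * \<bar>u x\<bar>" for n
    proof (rule AE_I2)
      fix x :: "real ^ 'n" assume "x \<in> space cube_measure"
      then have x: "0 \<le> x $ j" "x $ j \<le> 1" for j by (auto simp: mem_box_cart)
      have "\<bar>?s (x $ i) * cutoff' (N n) (x $ i)\<bar> \<le> pi * \<bar>of_int (k $ i)\<bar> * (3 + 3)"
        by (rule order_trans[OF sin_cutoff'_le])
          (use x[of i] N[of n] layer_bounds(2)[of "N n" "x $ i"] layer_bounds(2)[of "N n" "1 - x $ i"]
            in \<open>auto intro!: mult_left_mono\<close>)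
      moreover have "\<bar>?p * ?c i (x $ i) * cutoff (N n) (x $ i)\<bar> \<le> \<bar>?p\<bar> * 1 * 1"
        unfolding abs_mult using cutoff_bounds[of "N n" "x $ i"]
        by (intro mult_mono) auto
      \<comment> \<open>Each of the two layers is at most 3, and the remaining term contributes the seventh unit.\<close>
      ultimately have "\<bar>f' n (x $ i)\<bar> \<le> \<bar>?p\<bar> * 1 * 1 + pi * \<bar>of_int (k $ i)\<bar> * (3 + 3)"
        unfolding f'_def by (intro order_trans[OF abs_triangle_ineq add_mono])
      then have "\<bar>f' n (x $ i)\<bar> \<le> 7 * \<bar>?p\<bar>" by (simp add: abs_mult)
      moreover have "\<bar>\<Prod>j\<in>UNIV - {i}. f n j (x $ j)\<bar> \<le> 1"
        unfolding abs_prod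
        using cutoff_bounds[of "N n"] by (intro prod_le_1) (auto simp: f_def abs_mult intro!: mult_le_one)
      ultimately have "\<bar>tensor ((f n)(i := f' n)) x\<bar> \<le> 7 * \<bar>?p\<bar> * 1"
        unfolding tensor_upd abs_mult by (intro mult_mono) auto
      then have "\<bar>u x\<bar> * \<bar>tensor ((f n)(i := f' n)) x\<bar> \<le> \<bar>u x\<bar> * (7 * \<bar>?p\<bar> * 1)"
        by (rule mult_left_mono) simp
      then show "norm (u x * tensor ((f n)(i := f' n)) x) \<le> (7 * \<bar>?p\<bar>) * \<bar>u x\<bar>"
        by (simp add: abs_mult mult_ac)
    qed
  qed
  moreover have "(\<lambda>n. LINT x|cube_measure. g x $ i * tensor (f n) x) \<longlonglongrightarrow>
      (LINT x|cube_measure. g x $ i * sin_mode i k x)"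
  proof (rule integral_dominated_convergence[where w = "\<lambda>x. \<bar>g x $ i\<bar>"])
    show "(\<lambda>x. g x $ i * sin_mode i k x) \<in> borel_measurable cube_measure"
      using g continuous_cube_measurable[OF continuous_modes(2)[of _ i k]] by auto
    show "(\<lambda>x. g x $ i * tensor (f n) x) \<in> borel_measurable cube_measure" for n
      by (intro borel_measurable_times[OF borel_measurable_integrable[OF g]]
          continuous_cube_measurable continuous_on_tensor) (auto simp: smooth_continuous sm)
    show "integrable cube_measure (\<lambda>x. \<bar>g x $ i\<bar>)" using g by simp
    show "AE x in cube_measure. (\<lambda>n. g x $ i * tensor (f n) x) \<longlonglongrightarrow> g x $ i * sin_mode i k x"
      using AE_cube_interior
    proof eventually_elim
      case (elim x)
      then have x: "0 < x $ j" "x $ j < 1" for j by (auto simp: mem_box_cart)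
      have c1: "(\<lambda>n. cutoff (N n) (x $ j)) \<longlonglongrightarrow> 1" for j
        unfolding N_def by (rule LIMSEQ_Suc[OF cutoff_tendsto[OF x]])
      have "(\<lambda>n. tensor (f n) x) \<longlonglongrightarrow> ?s (x $ i) * 1 * (\<Prod>j\<in>UNIV - {i}. ?c j (x $ j) * 1)"
        unfolding f_def tensor_upd
        by (intro tendsto_mult tendsto_prod c1 tendsto_const)
      then show ?case
        unfolding sin_mode_def tensor_upd by (intro tendsto_mult tendsto_const) simp
    qed
    show "AE x in cube_measure. norm (g x $ i * tensor (f n) x) \<le> \<bar>g x $ i\<bar>" for n
    proof (rule AE_I2)
      fix x :: "real ^ 'n"
      have "\<bar>tensor (f n) x\<bar> \<le> 1"
        unfolding tensor_def abs_prod
        using cutoff_bounds[of "N n"] by (intro prod_le_1) (auto simp: f_def abs_mult intro!: mult_le_one)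
      then show "norm (g x $ i * tensor (f n) x) \<le> \<bar>g x $ i\<bar>"
        by (simp add: abs_mult mult_left_le)
    qed
  qed
  ultimately have "(LINT x|cube_measure. u x * (?p * cos_mode k x)) =
      - (LINT x|cube_measure. g x $ i * sin_mode i k x)"
    by (auto intro: LIMSEQ_unique tendsto_minus)
  moreover have "(LINT x|cube_measure. u x * (?p * cos_mode k x)) = ?p * (LINT x|cube_measure. u x * cos_mode k x)"
    by (simp flip: integral_mult_right_zero add: mult_ac)
  ultimately show ?thesis by simp
qed

section \<open>Cosine modes as elements of the Sobolev space\<close>

text \<open>
  Translation invariance of Lebesgue measure makes the integral of every difference quotient vanish; the
  quotients are bounded by the mean value theorem and supported in a fixed ball, so dominated convergence
  passes this to the derivative.
\<close>

lemma integral_directional_derivative_eq_0: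
  fixes F :: "real ^ 'n \<Rightarrow> real"
  assumes F: "\<And>x. (F has_derivative F' x) (at x)"
    and F': "continuous_on UNIV (\<lambda>x. F' x e)"
    and supp: "\<And>x. x \<notin> unit_cube \<Longrightarrow> F x = 0"
  shows "(LINT x|cube_measure. F' x e) = 0"
proof -
  define h where "h n = inverse (real (Suc n))" for n
  have h: "0 < h n" "h n \<le> 1" for n by (auto simp: h_def field_simps)
  define q where "q n x = (F (h n *\<^sub>R e + x) - F x) / h n" for n x
  have contF: "continuous_on UNIV F"
    using has_derivative_continuous[OF F] by (auto intro: continuous_at_imp_continuous_on)
  have F'0: "F' x e = 0" if "x \<notin> unit_cube" for x
  proof -
    have "(F has_derivative (\<lambda>_. 0)) (at x)"
      by (rule has_derivative_transform_within_open[OF has_derivative_const, of "- unit_cube"])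
        (use that supp in auto)
    from has_derivative_unique[OF this F[of x]] show ?thesis by metis
  qed
  obtain C where C: "C > 0" "\<And>x. x \<in> unit_cube \<Longrightarrow> \<bar>F' x e\<bar> \<le> C"
    using continuous_bounded_cube[OF F'] by metis
  then have C': "\<bar>F' x e\<bar> \<le> C" for x using F'0[of x] by (cases "x \<in> unit_cube") auto
  have line: "((\<lambda>t. F (t *\<^sub>R e + x)) has_real_derivative F' (t *\<^sub>R e + x) e) (at t)" for t x
  proof -
    have "((\<lambda>t. t *\<^sub>R e + x) has_derivative (\<lambda>t. t *\<^sub>R e)) (at t)"
      by (auto intro!: derivative_eq_intros)
    from has_derivative_compose[OF this F]
    have "((\<lambda>t. F (t *\<^sub>R e + x)) has_derivative (\<lambda>s. F' (t *\<^sub>R e + x) (s *\<^sub>R e))) (at t)" .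
    moreover have "linear (F' (t *\<^sub>R e + x))" using F has_derivative_linear by blast
    then have "(\<lambda>s. F' (t *\<^sub>R e + x) (s *\<^sub>R e)) = (*) (F' (t *\<^sub>R e + x) e)"
      by (auto simp: linear_cmul)
    ultimately show ?thesis
      by (simp add: has_field_derivative_def)
  qed
  have qb: "\<bar>q n x\<bar> \<le> C" for n x
  proof -
    obtain z where "F (h n *\<^sub>R e + x) - F (0 *\<^sub>R e + x) = (h n - 0) * F' (z *\<^sub>R e + x) e"
      using MVT2[OF h(1)[of n], of "\<lambda>t. F (t *\<^sub>R e + x)" "\<lambda>t. F' (t *\<^sub>R e + x) e"] line by metis
    then show ?thesis using C' h(1)[of n] by (simp add: q_def)
  qed
  have h0: "h \<longlonglongrightarrow> 0" unfolding h_def[abs_def] by (rule LIMSEQ_inverse_real_of_nat)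
  have qlim: "(\<lambda>n. q n x) \<longlonglongrightarrow> F' x e" for x
  proof -
    have "((\<lambda>t. (F ((0 + t) *\<^sub>R e + x) - F (0 *\<^sub>R e + x)) / t) \<longlongrightarrow> F' x e) (at 0)"
      using line[of x 0] by (simp add: DERIV_def)
    moreover have "filterlim h (at 0) sequentially"
      using h0 h(1) by (auto simp: filterlim_at intro!: always_eventually less_imp_neq[symmetric])
    ultimately show ?thesis
      unfolding q_def by (auto dest: filterlim_compose)
  qed
  have intF: "integrable lborel F"
  proof -
    have "integrable lborel (\<lambda>x. indicator unit_cube x *\<^sub>R F x)"
      by (rule borel_integrable_compact) (use contF continuous_on_subset in auto)
    also have "(\<lambda>x. indicator unit_cube x *\<^sub>R F x) = F"
      using supp by (auto simp: indicator_def fun_eq_iff)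
    finally show ?thesis .
  qed
  have Fb: "F \<in> borel_measurable borel" using contF by (rule borel_measurable_continuous_onI)
  have F'b: "(\<lambda>x. F' x e) \<in> borel_measurable borel" using F' by (rule borel_measurable_continuous_onI)
  have shift: "integrable lborel (\<lambda>x. F (c + x))" "(LINT x|lborel. F (c + x)) = (LINT x|lborel. F x)" for c
  proof -
    have "integrable (distr lborel borel ((+) c)) F" using intF by (simp add: lborel_distr_plus)
    then show "integrable lborel (\<lambda>x. F (c + x))" by (subst (asm) integrable_distr_eq) (use Fb in auto)
    have "(LINT x|lborel. F x) = (LINT x|distr lborel borel ((+) c). F x)" by (simp add: lborel_distr_plus)
    then show "(LINT x|lborel. F (c + x)) = (LINT x|lborel. F x)"
      by (subst (asm) integral_distr) (use Fb in auto)
  qed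
  have q0: "(LINT x|lborel. q n x) = 0" for n
    unfolding q_def using shift intF by simp
  obtain R where R: "unit_cube \<subseteq> cball (0 :: real ^ 'n) R"
    using bounded_cbox[of 0 "1 :: real ^ 'n"] bounded_pos[of unit_cube] by (auto simp: subset_iff)
  \<comment> \<open>The steps \<open>h n\<close> are at most 1, so all translates of the support lie in this ball.\<close>
  let ?B = "cball 0 (R + norm e)"
  have "(\<lambda>n. LINT x|lborel. q n x) \<longlonglongrightarrow> (LINT x|lborel. F' x e)"
  proof (rule integral_dominated_convergence[where w = "\<lambda>x. indicator ?B x *\<^sub>R C"])
    show "integrable lborel (\<lambda>x. indicator ?B x *\<^sub>R C)"
      by (rule borel_integrable_compact) auto
    show "(\<lambda>x. F' x e) \<in> borel_measurable lborel" using F'b by simp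
    show "q n \<in> borel_measurable lborel" for n unfolding q_def using Fb by measurable
    show "AE x in lborel. (\<lambda>n. q n x) \<longlonglongrightarrow> F' x e" using qlim by simp
    show "AE x in lborel. norm (q n x) \<le> indicator ?B x *\<^sub>R C" for n
    proof (rule AE_I2)
      fix x
      show "norm (q n x) \<le> indicator ?B x *\<^sub>R C"
      proof (cases "x \<in> ?B")
        case False
        then have *: "norm x > R + norm e" by simp
        have "norm (h n *\<^sub>R e) \<le> norm e" using h[of n] by (simp add: mult_left_le_one_le)
        then have "norm (h n *\<^sub>R e + x) > R"
          using * norm_diff_ineq[of x "h n *\<^sub>R e"] by (simp add: add.commute)
        then have "h n *\<^sub>R e + x \<notin> unit_cube" using R by auto
        moreover have "x \<notin> cball 0 R" using * norm_ge_zero[of e] unfolding mem_cball_0 by linarith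
        then have "x \<notin> unit_cube" using R by blast
        ultimately show ?thesis using False by (simp add: q_def supp)
      qed (use qb in simp)
    qed
  qed
  then have "(LINT x|lborel. F' x e) = 0" using q0 by (simp add: LIMSEQ_const_iff)
  moreover have "(LINT x|lborel. F' x e) = (LINT x|lebesgue. F' x e)"
    by (rule integral_completion[symmetric]) (use F'b in simp)
  moreover have "(LINT x|lebesgue. F' x e) = (LINT x|lebesgue. indicator unit_cube x *\<^sub>R F' x e)"
    by (rule Bochner_Integration.integral_cong) (use F'0 in \<open>auto simp: indicator_def\<close>)
  ultimately show ?thesis by (simp add: integral_restrict_space)
qed

text \<open>
  The product with a test function has compact support in the open cube, so the integral of its partial
  derivative vanishes.
\<close>

lemma has_weak_gradient_classical:
  fixes f :: "real ^ 'n \<Rightarrow> real"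
  assumes f: "\<And>x. (f has_derivative (\<lambda>v. \<Sum>i\<in>UNIV. v $ i * G x $ i)) (at x)"
    and G: "\<And>i. continuous_on UNIV (\<lambda>x. G x $ i)"
  shows "has_weak_gradient f G"
  unfolding has_weak_gradient_def
proof (intro allI impI)
  fix \<phi> :: "real ^ 'n \<Rightarrow> real" and i :: 'n
  assume "test_function \<phi>"
  then have Ck: "Ck 1 \<phi>" and supp: "closure {x. \<phi> x \<noteq> 0} \<subseteq> interior unit_cube"
    by (auto simp: test_function_def)
  have \<phi>': "continuous_on UNIV (partial_deriv i \<phi>)"
    using Ck by simp
  have "\<phi> differentiable at x" for x
    using Ck by (simp add: differentiable_on_def)
  then have \<phi>: "(\<phi> has_derivative frechet_derivative \<phi> (at x)) (at x)" for x
    by (simp add: frechet_derivative_works)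
  have c: "continuous_on UNIV \<phi>" "continuous_on UNIV f"
    using has_derivative_continuous[OF \<phi>] has_derivative_continuous[OF f]
    by (auto intro: continuous_at_imp_continuous_on)
  have e: "(\<Sum>j\<in>UNIV. axis i 1 $ j * G x $ j) = G x $ i" for x
    by (simp add: axis_def if_distrib[of "\<lambda>y. y * _"] cong: if_cong)
  let ?F' = "\<lambda>x v. f x * frechet_derivative \<phi> (at x) v + (\<Sum>j\<in>UNIV. v $ j * G x $ j) * \<phi> x"
  have eq: "?F' x (axis i 1) = f x * partial_deriv i \<phi> x + G x $ i * \<phi> x" for x
    by (simp add: e partial_deriv_def)
  have "(LINT x|cube_measure. ?F' x (axis i 1)) = 0"
  proof (rule integral_directional_derivative_eq_0)
    show "((\<lambda>x. f x * \<phi> x) has_derivative ?F' x) (at x)" for x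
      by (rule has_derivative_mult[OF f \<phi>])
    show "continuous_on UNIV (\<lambda>x. ?F' x (axis i 1))"
      unfolding eq by (intro continuous_intros c G \<phi>')
    show "f x * \<phi> x = 0" if "x \<notin> unit_cube" for x
    proof -
      have "\<phi> x = 0"
        using that supp closure_subset[of "{x. \<phi> x \<noteq> 0}"] interior_subset[of unit_cube] by blast
      then show ?thesis by simp
    qed
  qed
  moreover have "integrable cube_measure (\<lambda>x. f x * partial_deriv i \<phi> x)"
    "integrable cube_measure (\<lambda>x. G x $ i * \<phi> x)"
    by (intro integrable_continuous_cube continuous_intros c G \<phi>')+
  ultimately show "(LINT x|cube_measure. f x * partial_deriv i \<phi> x) =
      - (LINT x|cube_measure. G x $ i * \<phi> x)"
    by (simp add: eq)
qed

definition cos_mode_gradient :: "int ^ 'n \<Rightarrow> real ^ 'n \<Rightarrow> real ^ 'n" where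
  "cos_mode_gradient k x = (\<chi> i. - (pi * of_int (k $ i)) * sin_mode i k x)"

lemma continuous_cos_mode_gradient: "continuous_on A (cos_mode_gradient k)"
  unfolding cos_mode_gradient_def[abs_def]
  by (intro continuous_on_vec_lambda continuous_intros continuous_modes)

lemma square_integrable_continuous:
  fixes f :: "real ^ 'n \<Rightarrow> 'b :: euclidean_space"
  assumes "continuous_on UNIV f" shows "square_integrable f"
  unfolding square_integrable_def
  using assms by (auto intro!: continuous_imp_measurable_on_sets_lebesgue integrable_continuous_cube
      continuous_intros intro: continuous_on_subset)

lemma cos_mode_H1: "has_H1_gradient (cos_mode k) (cos_mode_gradient k)"
  unfolding has_H1_gradient_def
proof (intro conjI)
  show "has_weak_gradient (cos_mode k) (cos_mode_gradient k)"
  proof (rule has_weak_gradient_classical)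
    show "(cos_mode k has_derivative (\<lambda>v. \<Sum>i\<in>UNIV. v $ i * cos_mode_gradient k x $ i)) (at x)" for x
      using cos_mode_has_derivative[of k x] by (simp add: cos_mode_gradient_def)
    show "continuous_on UNIV (\<lambda>x. cos_mode_gradient k x $ i)" for i
      by (intro continuous_intros continuous_cos_mode_gradient)
  qed
qed (auto intro: square_integrable_continuous continuous_modes continuous_cos_mode_gradient)

section \<open>Products and orthogonality of cosine modes\<close>

text \<open>
  The sign pattern \<open>\<sigma>\<close> ranges over all functions to \<open>bool\<close>, also where \<open>m\<close> has zero entries, so that a
  frequency may be hit several times. This keeps the product formula a plain average over \<open>2 ^ CARD('n)\<close>
  patterns.
\<close>

definition signed_index :: "('n \<Rightarrow> bool) \<Rightarrow> nat ^ 'n \<Rightarrow> int ^ 'n" where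
  "signed_index \<sigma> m = (\<chi> i. if \<sigma> i then int (m $ i) else - int (m $ i))"

lemma signed_index_nth: "signed_index \<sigma> m $ i = (if \<sigma> i then int (m $ i) else - int (m $ i))"
  by (simp add: signed_index_def)

lemma cos_mode_signed: "cos_mode (signed_index \<sigma> m) = cos_basis m"
  unfolding cos_mode_def cos_basis_def tensor_def signed_index_def
  by (auto intro!: ext prod.cong)

text \<open>
  Expand \<open>cos a * cos b = (cos (a + b) + cos (a - b)) / 2\<close> in every coordinate and multiply out.
\<close>

lemma cos_mode_times_basis:
  fixes k :: "int ^ 'n"
  shows "cos_mode k x * cos_basis m x =
    (\<Sum>\<sigma>\<in>UNIV. cos_mode (k + signed_index \<sigma> m) x) / 2 ^ CARD('n)"
proof -
  let ?a = "\<lambda>i. pi * real_of_int (k $ i) * x $ i" and ?b = "\<lambda>i. pi * real (m $ i) * x $ i"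
  have "cos (?a i) * cos (?b i) =
      (\<Sum>\<beta>\<in>UNIV. cos (pi * real_of_int (k $ i + (if \<beta> then int (m $ i) else - int (m $ i))) * x $ i) / 2)" for i
  proof -
    have "cos (?a i) * cos (?b i) = cos (?a i + ?b i) / 2 + cos (?a i - ?b i) / 2"
      by (simp add: cos_add cos_diff field_simps)
    then show ?thesis by (simp add: UNIV_bool algebra_simps)
  qed
  then have "cos_mode k x * cos_basis m x = (\<Prod>i\<in>UNIV. \<Sum>\<beta>\<in>UNIV.
      cos (pi * real_of_int (k $ i + (if \<beta> then int (m $ i) else - int (m $ i))) * x $ i) / 2)"
    by (simp add: cos_mode_def cos_basis_def tensor_def flip: prod.distrib)
  also have "\<dots> = (\<Sum>\<sigma>\<in>PiE UNIV (\<lambda>_. UNIV). \<Prod>i\<in>UNIV.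
      cos (pi * real_of_int (k $ i + (if \<sigma> i then int (m $ i) else - int (m $ i))) * x $ i) / 2)"
    by (rule prod_sum_PiE) auto
  also have "\<dots> = (\<Sum>\<sigma>\<in>UNIV. cos_mode (k + signed_index \<sigma> m) x / 2 ^ CARD('n))"
    by (simp add: cos_mode_def tensor_def signed_index_def PiE_UNIV_domain prod_dividef)
  finally show ?thesis by (simp add: sum_divide_distrib)
qed

text \<open>
  The unnormalised cosine coefficient, extended to \<open>int ^ 'n\<close>.
\<close>

definition moment :: "(real ^ 'n \<Rightarrow> real) \<Rightarrow> int ^ 'n \<Rightarrow> real" where
  "moment u k = (LINT x|cube_measure. u x * cos_mode k x)"

lemma integrable_mult_cos_mode:
  "integrable cube_measure u \<Longrightarrow> integrable cube_measure (\<lambda>x. u x * cos_mode k x)"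
  by (intro integrable_mult_continuous continuous_modes)

lemma continuous_cos_basis: "continuous_on A (cos_basis m)"
  using continuous_modes(1)[of A "signed_index (\<lambda>_. True) m"] by (simp add: cos_mode_signed)

lemma cos_basis_bound: "\<bar>cos_basis m x\<bar> \<le> 1"
  using cos_mode_bound[of "signed_index (\<lambda>_. True) m" x] by (simp add: cos_mode_signed)

lemma moment_mult_basis:
  fixes u :: "real ^ 'n \<Rightarrow> real"
  assumes "integrable cube_measure u"
  shows "(LINT x|cube_measure. u x * (cos_mode k x * cos_basis m x)) =
    (\<Sum>\<sigma>\<in>UNIV. moment u (k + signed_index \<sigma> m)) / 2 ^ CARD('n)"
  using integrable_mult_cos_mode[OF assms]
  by (simp add: cos_mode_times_basis sum_distrib_left moment_def)

lemma abs_moment_le: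
  assumes "integrable cube_measure u"
  shows "\<bar>moment u k\<bar> \<le> (LINT x|cube_measure. \<bar>u x\<bar>)"
proof -
  note int = integrable_mult_cos_mode[OF assms, of k]
  have "\<bar>moment u k\<bar> \<le> (LINT x|cube_measure. \<bar>u x * cos_mode k x\<bar>)"
    unfolding moment_def by (rule integral_abs_bound)
  also have "\<dots> \<le> (LINT x|cube_measure. \<bar>u x\<bar>)"
  proof (rule integral_mono[OF integrable_abs[OF int] integrable_abs[OF assms]])
    show "\<bar>u x * cos_mode k x\<bar> \<le> \<bar>u x\<bar>" for x
      unfolding abs_mult by (rule mult_left_le[OF cos_mode_bound]) simp
  qed
  finally show ?thesis .
qed

lemma measure_cube: "measure cube_measure (unit_cube :: (real ^ 'n) set) = 1"
proof -
  have "(0 :: real ^ 'n) \<in> cbox 0 1" by (simp add: mem_box_cart)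
  then have "cbox 0 (1 :: real ^ 'n) \<noteq> {}" by blast
  then show ?thesis by (simp add: measure_restrict_space content_cbox_cart)
qed

text \<open>
  Both modes are eigenfunctions of the second derivative in the \<open>i\<close>-th variable, with eigenvalues
  \<open>- \<pi>\<^sup>2 (k $ i)\<^sup>2\<close> and \<open>- \<pi>\<^sup>2 (m $ i)\<^sup>2\<close>; integration by parts in either order moves the derivative from one to the
  other.
\<close>

lemma cos_mode_orthogonal:
  fixes k m :: "int ^ 'n"
  assumes "(k $ i)\<^sup>2 \<noteq> (m $ i)\<^sup>2"
  shows "(LINT x|cube_measure. cos_mode k x * cos_mode m x) = 0"
proof -
  have *: "real_of_int (k $ i) * (LINT x|cube_measure. sin_mode i k x * sin_mode i m x) =
      real_of_int (m $ i) * (LINT x|cube_measure. cos_mode k x * cos_mode m x)" for k m :: "int ^ 'n"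
  proof -
    have "(LINT x|cube_measure. cos_mode_gradient k x $ i * sin_mode i m x) =
         - (pi * of_int (m $ i)) * (LINT x|cube_measure. cos_mode k x * cos_mode m x)"
    proof (rule weak_gradient_against_sin_mode)
      show "has_weak_gradient (cos_mode k) (cos_mode_gradient k)"
        using cos_mode_H1[of k] by (simp add: has_H1_gradient_def)
    qed (auto intro!: integrable_continuous_cube continuous_modes continuous_intros
        continuous_cos_mode_gradient)
    moreover have "(\<lambda>x. cos_mode_gradient k x $ i * sin_mode i m x) =
        (\<lambda>x. - (pi * of_int (k $ i)) * (sin_mode i k x * sin_mode i m x))"
      by (simp add: cos_mode_gradient_def fun_eq_iff)
    ultimately have "pi * (real_of_int (k $ i) * (LINT x|cube_measure. sin_mode i k x * sin_mode i m x)) =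
      pi * (real_of_int (m $ i) * (LINT x|cube_measure. cos_mode k x * cos_mode m x))"
      by (simp add: mult.assoc)
    then show ?thesis by simp
  qed
  let ?S = "LINT x|cube_measure. sin_mode i k x * sin_mode i m x"
  let ?I = "LINT x|cube_measure. cos_mode k x * cos_mode m x"
  have km: "real_of_int (k $ i) * ?S = real_of_int (m $ i) * ?I"
    using *[of k m] .
  have mk: "real_of_int (m $ i) * ?S = real_of_int (k $ i) * ?I"
    using *[of m k] by (simp only: mult.commute[of "cos_mode m _"] mult.commute[of "sin_mode i m _"])
  have "(real_of_int (k $ i))\<^sup>2 * ?I = real_of_int (k $ i) * (real_of_int (m $ i) * ?S)"
    unfolding mk by (simp add: power2_eq_square)
  also have "\<dots> = real_of_int (m $ i) * (real_of_int (k $ i) * ?S)" by simp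
  also have "\<dots> = (real_of_int (m $ i))\<^sup>2 * ?I"
    unfolding km by (simp add: power2_eq_square)
  finally have "(real_of_int (k $ i))\<^sup>2 * ?I = (real_of_int (m $ i))\<^sup>2 * ?I" .
  moreover have "(real_of_int (k $ i))\<^sup>2 \<noteq> (real_of_int (m $ i))\<^sup>2"
    using assms by (metis of_int_eq_iff of_int_power)
  ultimately show ?thesis by simp
qed

lemma integral_cos_mode: "(LINT x|cube_measure. cos_mode k x) = (if k = 0 then 1 else 0)"
proof (cases "k = 0")
  case True
  then show ?thesis using measure_cube by (simp add: cos_mode_def tensor_def)
next
  case False
  then obtain i where "k $ i \<noteq> 0" by (auto simp: vec_eq_iff)
  then show ?thesis
    using False cos_mode_orthogonal[of k i 0] by (simp add: cos_mode_def tensor_def)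
qed

lemma cos_basis_orthogonal:
  assumes "k \<noteq> m" shows "(LINT x|cube_measure. cos_basis k x * cos_basis m x) = 0"
proof -
  obtain i where "k $ i \<noteq> m $ i" using assms by (auto simp: vec_eq_iff)
  then show ?thesis
    using cos_mode_orthogonal[of "signed_index (\<lambda>_. True) k" i "signed_index (\<lambda>_. True) m"]
    by (simp add: cos_mode_signed signed_index_nth)
qed

text \<open>
  By the product formula, the square is an average of \<open>2 ^ CARD('n)\<close> modes whose integrals are 0 or 1, and the
  sign pattern that cancels \<open>m\<close> contributes a 1.
\<close>

lemma cos_basis_norm_ge:
  fixes m :: "nat ^ 'n"
  shows "1 / 2 ^ CARD('n) \<le> (LINT x|cube_measure. (cos_basis m x)\<^sup>2)"
proof -
  let ?k = "\<lambda>\<sigma>. signed_index (\<lambda>_. True) m + signed_index \<sigma> m"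
  have "(LINT x|cube_measure. (cos_basis m x)\<^sup>2) =
      (LINT x|cube_measure. (\<Sum>\<sigma>\<in>UNIV. cos_mode (?k \<sigma>) x) / 2 ^ CARD('n))"
    by (simp add: power2_eq_square cos_mode_signed flip: cos_mode_times_basis)
  also have "\<dots> = (\<Sum>\<sigma>\<in>UNIV. if ?k \<sigma> = 0 then 1 else 0) / 2 ^ CARD('n)"
    by (simp add: integral_cos_mode integrable_continuous_cube continuous_modes)
  also have "(\<Sum>\<sigma>\<in>UNIV. if ?k \<sigma> = 0 then 1 else 0) \<ge> (\<Sum>\<sigma>\<in>{\<lambda>_. False}. if ?k \<sigma> = 0 then 1 else (0::real))"
    by (rule sum_mono2) auto
  moreover have "?k (\<lambda>_. False) = 0" by (simp add: vec_eq_iff signed_index_nth)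
  ultimately show ?thesis by (simp add: divide_right_mono)
qed

lemma cos_coeff_eq: "(LINT x|cube_measure. u x * cos_basis m x) =
   cos_coeff u m * (LINT x|cube_measure. (cos_basis m x)\<^sup>2)"
proof -
  have "(LINT x|cube_measure. (cos_basis m x)\<^sup>2) > 0"
    by (rule less_le_trans[OF _ cos_basis_norm_ge]) simp
  then show ?thesis by (simp add: cos_coeff_def)
qed

lemma abs_cos_coeff_le:
  fixes u :: "real ^ 'n \<Rightarrow> real"
  shows "\<bar>cos_coeff u m\<bar> \<le> 2 ^ CARD('n) * \<bar>moment u (signed_index (\<lambda>_. True) m)\<bar>"
proof -
  let ?N = "LINT x|cube_measure. (cos_basis m x)\<^sup>2"
  have "\<bar>cos_coeff u m\<bar> * 1 \<le> \<bar>cos_coeff u m\<bar> * (?N * 2 ^ CARD('n))"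
    using cos_basis_norm_ge[of m] by (intro mult_left_mono) (auto simp: field_simps)
  also have "\<dots> = 2 ^ CARD('n) * \<bar>cos_coeff u m * ?N\<bar>"
    by (simp add: abs_mult)
  finally show ?thesis
    by (simp add: moment_def cos_mode_signed flip: cos_coeff_eq)
qed

section \<open>Completeness of the cosine basis\<close>

text \<open>
  The linear span of the cosine basis. It is an algebra by the product formula, it separates the points of
  the cube because the cosine is injective on \<open>{0..\<pi>}\<close>, and so it is dense by the theorem of Stone and
  Weierstrass.
\<close>

inductive cos_polynomial :: "(real ^ 'n \<Rightarrow> real) \<Rightarrow> bool" where
  mode: "cos_polynomial (\<lambda>x. c * cos_basis m x)"
| add: "cos_polynomial f \<Longrightarrow> cos_polynomial g \<Longrightarrow> cos_polynomial (\<lambda>x. f x + g x)"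

lemma cos_polynomial_const: "cos_polynomial (\<lambda>x. c)"
  using cos_polynomial.mode[of c 0] by (simp add: cos_basis_def)

lemma cos_polynomial_sum:
  "finite A \<Longrightarrow> (\<And>a. a \<in> A \<Longrightarrow> cos_polynomial (f a)) \<Longrightarrow> cos_polynomial (\<lambda>x. \<Sum>a\<in>A. f a x)"
  by (induction A rule: finite_induct) (auto intro: cos_polynomial_const cos_polynomial.add)

lemma cos_mode_eq_basis: "cos_mode k = cos_basis (\<chi> i. nat \<bar>k $ i\<bar>)"
proof -
  have "cos (pi * real_of_int a * t) = cos (pi * real (nat \<bar>a\<bar>) * t)" for a t
    by (cases "a \<ge> 0") auto
  then show ?thesis
    by (auto simp: cos_mode_def cos_basis_def tensor_def intro!: ext prod.cong)
qed

lemma cos_polynomial_mult_basis: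
  assumes "cos_polynomial f" shows "cos_polynomial (\<lambda>x. f x * (c * cos_basis m x))"
  using assms
proof induction
  case (mode c' k)
  have eq: "c' * cos_basis k x * (c * cos_basis m x) = (\<Sum>\<sigma>\<in>UNIV. (c' * c / 2 ^ CARD('a)) *
      cos_basis (\<chi> i. nat \<bar>(signed_index (\<lambda>_. True) k + signed_index \<sigma> m) $ i\<bar>) x)" for x
  proof -
    have "c' * cos_basis k x * (c * cos_basis m x) =
        c' * c * (cos_mode (signed_index (\<lambda>_. True) k) x * cos_basis m x)"
      by (simp add: cos_mode_signed)
    also have "\<dots> = (\<Sum>\<sigma>\<in>UNIV. (c' * c / 2 ^ CARD('a)) *
        cos_mode (signed_index (\<lambda>_. True) k + signed_index \<sigma> m) x)"
      by (simp add: cos_mode_times_basis sum_distrib_left sum_divide_distrib)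
    finally show ?thesis unfolding cos_mode_eq_basis[symmetric] .
  qed
  show ?case
    unfolding eq by (intro cos_polynomial_sum cos_polynomial.mode) auto
next
  case (add f g)
  then show ?case by (auto simp: distrib_right intro: cos_polynomial.add)
qed

lemma cos_polynomial_mult:
  assumes "cos_polynomial g" "cos_polynomial f"
  shows "cos_polynomial (\<lambda>x. f x * g x)"
  using assms
proof induction
  case (mode c m)
  then show ?case by (rule cos_polynomial_mult_basis)
next
  case (add g h)
  then show ?case by (auto simp: distrib_left intro: cos_polynomial.add)
qed

lemma continuous_cos_polynomial: "cos_polynomial f \<Longrightarrow> continuous_on A f"
  by (induction rule: cos_polynomial.induct) (auto intro!: continuous_intros continuous_cos_basis)

lemma cos_polynomial_dense:
  fixes f :: "real ^ 'n \<Rightarrow> real"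
  assumes "continuous_on unit_cube f" "e > 0"
  shows "\<exists>p. cos_polynomial p \<and> (\<forall>x\<in>unit_cube. \<bar>f x - p x\<bar> < e)"
proof (rule Stone_Weierstrass_HOL[of unit_cube cos_polynomial, OF compact_cbox])
  fix x y :: "real ^ 'n" assume xy: "x \<in> unit_cube \<and> y \<in> unit_cube \<and> x \<noteq> y"
  then obtain i where i: "x $ i \<noteq> y $ i" by (auto simp: vec_eq_iff)
  have ev: "cos_basis (axis i 1) z = cos (pi * z $ i)" for z :: "real ^ 'n"
    unfolding cos_basis_def by (subst prod.remove[of UNIV i]) (auto simp: axis_def intro!: prod.neutral)
  have "0 \<le> x $ i" "x $ i \<le> 1" "0 \<le> y $ i" "y $ i \<le> 1" using xy by (auto simp: mem_box_cart)
  then have "cos (pi * x $ i) \<noteq> cos (pi * y $ i)"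
    using i cos_inj_pi[of "pi * x $ i" "pi * y $ i"] by auto
  then have "cos_basis (axis i 1) x \<noteq> cos_basis (axis i 1) y" unfolding ev .
  moreover have "cos_polynomial (cos_basis (axis i 1 :: nat ^ 'n))"
    using cos_polynomial.mode[of 1] by simp
  ultimately show "\<exists>p. cos_polynomial p \<and> p x \<noteq> p y" by blast
qed (use assms in \<open>auto intro: cos_polynomial_const continuous_cos_polynomial cos_polynomial.add cos_polynomial_mult\<close>)

text \<open>
  If \<open>D\<close> is orthogonal to the cosine basis, it is orthogonal to all continuous functions by density. As \<open>D\<close> is
  the almost everywhere limit of continuous functions, which may be truncated at height \<open>B\<close>, it is
  orthogonal to itself.
\<close>

lemma cos_basis_complete:
  fixes D :: "real ^ 'n \<Rightarrow> real"
  assumes D: "D \<in> borel_measurable cube_measure" and B: "\<And>x. x \<in> unit_cube \<Longrightarrow> \<bar>D x\<bar> \<le> B"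
    and 0: "\<And>m. (LINT x|cube_measure. D x * cos_basis m x) = 0"
  shows "AE x in cube_measure. D x = 0"
proof -
  interpret finite_measure "cube_measure :: (real ^ 'n) measure" by (rule finite_measure_cube)
  have "\<bar>D 0\<bar> \<le> B" by (rule B) (simp add: mem_box_cart)
  then have B0: "0 \<le> B" by linarith
  have intD: "integrable cube_measure D"
    by (rule integrable_const_bound[of _ B]) (use D B in auto)
  have poly: "(LINT x|cube_measure. D x * p x) = 0" if "cos_polynomial p" for p
    using that
  proof induction
    case (mode c m)
    then show ?case using 0[of m] by (simp add: mult.left_commute[of _ c])
  next
    case (add f g)
    then show ?case
      using integrable_mult_continuous[OF intD continuous_cos_polynomial]
      by (simp add: distrib_left)
  qed
  have cont: "(LINT x|cube_measure. D x * f x) = 0" if f: "continuous_on UNIV f" for f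
  proof -
    have "\<bar>LINT x|cube_measure. D x * f x\<bar> \<le> B * e" if "e > 0" for e
    proof -
      obtain p where p: "cos_polynomial p" "\<And>x. x \<in> unit_cube \<Longrightarrow> \<bar>f x - p x\<bar> < e"
        using cos_polynomial_dense[OF continuous_on_subset[OF f] \<open>e > 0\<close>] by auto
      note int = integrable_mult_continuous[OF intD f]
        integrable_mult_continuous[OF intD continuous_cos_polynomial[OF p(1)]]
      have "(LINT x|cube_measure. D x * f x) = (LINT x|cube_measure. D x * f x - D x * p x)"
        using int by (simp add: poly[OF p(1)])
      also have "\<bar>\<dots>\<bar> \<le> (LINT x|cube_measure. \<bar>D x * f x - D x * p x\<bar>)"
        by (rule integral_abs_bound)
      also have "\<dots> \<le> (LINT x|(cube_measure :: (real ^ 'n) measure). B * e)"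
      proof (rule integral_mono)
        fix x :: "real ^ 'n" assume "x \<in> space cube_measure"
        then have "\<bar>D x\<bar> * \<bar>f x - p x\<bar> \<le> B * e"
          using B[of x] p(2)[of x] B0 by (intro mult_mono) auto
        then show "\<bar>D x * f x - D x * p x\<bar> \<le> B * e"
          by (simp flip: abs_mult right_diff_distrib)
      qed (use int in auto)
      also have "\<dots> = B * e" by (simp add: measure_cube)
      finally show ?thesis .
    qed
    then have lim: "\<bar>LINT x|cube_measure. D x * f x\<bar> \<le> B * inverse (real (Suc n))" for n by simp
    have "(\<lambda>n. B * inverse (real (Suc n))) \<longlonglongrightarrow> B * 0"
      by (intro tendsto_intros LIMSEQ_inverse_real_of_nat)
    then have "\<bar>LINT x|cube_measure. D x * f x\<bar> \<le> B * 0"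
      by (rule LIMSEQ_le_const) (use lim in auto)
    then show ?thesis by simp
  qed
  have "D measurable_on unit_cube"
    using D by (simp add: measurable_on_iff_borel_measurable)
  then obtain N g where N: "negligible N" and g: "\<And>n. continuous_on UNIV (g n)"
    and lim: "\<And>x. x \<notin> N \<Longrightarrow> (\<lambda>n. g n x) \<longlonglongrightarrow> (if x \<in> unit_cube then D x else 0)"
    by (auto simp: measurable_on_def)
  define g' where "g' n x = max (- B) (min B (g n x))" for n x
  have g': "continuous_on UNIV (g' n)" for n
    unfolding g'_def[abs_def] by (intro continuous_intros g)
  have "(\<lambda>n. LINT x|cube_measure. D x * g' n x) \<longlonglongrightarrow> (LINT x|cube_measure. D x * D x)"
  proof (rule integral_dominated_convergence[where w = "\<lambda>x. B * \<bar>D x\<bar>"])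
    show "(\<lambda>x. D x * g' n x) \<in> borel_measurable cube_measure" for n
      using continuous_cube_measurable[OF g'] D by simp
    have "AE x in lebesgue. x \<notin> N"
      using N by (intro AE_not_in) (simp add: negligible_iff_null_sets)
    then have "AE x in cube_measure. x \<notin> N"
      by (auto simp: AE_restrict_space_iff elim: eventually_mono)
    then show "AE x in cube_measure. (\<lambda>n. D x * g' n x) \<longlonglongrightarrow> D x * D x"
    proof (rule AE_mp, intro AE_I2 impI)
      fix x :: "real ^ 'n" assume "x \<in> space cube_measure" "x \<notin> N"
      then have x: "(\<lambda>n. g n x) \<longlonglongrightarrow> D x" "\<bar>D x\<bar> \<le> B" using lim[of x] B[of x] by auto
      have "(\<lambda>n. g' n x) \<longlonglongrightarrow> max (- B) (min B (D x))"
        unfolding g'_def by (intro tendsto_intros x)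
      also have "max (- B) (min B (D x)) = D x" using x(2) by auto
      finally show "(\<lambda>n. D x * g' n x) \<longlonglongrightarrow> D x * D x" by (intro tendsto_intros)
    qed
    show "AE x in cube_measure. norm (D x * g' n x) \<le> B * \<bar>D x\<bar>" for n
    proof (rule AE_I2)
      fix x
      have "\<bar>g' n x\<bar> \<le> B" using B0 by (auto simp: g'_def)
      then show "norm (D x * g' n x) \<le> B * \<bar>D x\<bar>"
        by (simp add: abs_mult mult.commute[of B] mult_left_mono)
    qed
  qed (use D intD in auto)
  then have "(LINT x|cube_measure. D x * D x) = 0"
    by (simp add: cont[OF g'] LIMSEQ_const_iff)
  moreover have "integrable cube_measure (\<lambda>x. D x * D x)"
    by (rule integrable_mult_bounded[OF intD D]) (use B in auto)
  ultimately show ?thesis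
    by (subst (asm) integral_nonneg_eq_0_iff_AE) auto
qed

definition cos_series :: "(nat ^ 'n \<Rightarrow> real) \<Rightarrow> real ^ 'n \<Rightarrow> real" where
  "cos_series q x = (\<Sum>\<^sub>\<infinity>m. q m * cos_basis m x)"

lemma cos_series_uniform:
  assumes "(\<lambda>m. \<bar>q m\<bar>) summable_on UNIV"
  shows "uniform_limit UNIV (\<lambda>A x. \<Sum>m\<in>A. q m * cos_basis m x) (cos_series q) (finite_subsets_at_top UNIV)"
  unfolding cos_series_def[abs_def]
  by (rule Weierstrass_m_test_general[OF _ assms])
    (simp add: abs_mult mult_left_le cos_basis_bound)

lemma cos_series_approx:
  assumes "(\<lambda>m. \<bar>q m\<bar>) summable_on UNIV" "e > 0" "finite A0"
  obtains A where "finite A" "A0 \<subseteq> A" "\<And>x. \<bar>cos_series q x - (\<Sum>m\<in>A. q m * cos_basis m x)\<bar> < e"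
proof -
  have "\<forall>\<^sub>F A in finite_subsets_at_top UNIV. \<forall>x\<in>UNIV. dist (\<Sum>m\<in>A. q m * cos_basis m x) (cos_series q x) < e"
    by (rule uniform_limitD[OF cos_series_uniform[OF assms(1)] assms(2)])
  then obtain X where X: "finite X" "\<And>A x. finite A \<Longrightarrow> X \<subseteq> A \<Longrightarrow>
      dist (\<Sum>m\<in>A. q m * cos_basis m x) (cos_series q x) < e"
    by (auto simp: eventually_finite_subsets_at_top)
  show ?thesis
    by (rule that[of "X \<union> A0"]) (use X(2)[of "X \<union> A0"] X(1) assms(3) in \<open>auto simp: dist_real_def abs_minus_commute\<close>)
qed

lemma continuous_cos_series:
  assumes "(\<lambda>m. \<bar>q m\<bar>) summable_on UNIV" shows "continuous_on A (cos_series q)"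
proof -
  have "continuous_on UNIV (cos_series q)"
    by (rule uniform_limit_theorem[OF _ cos_series_uniform[OF assms]])
      (auto intro!: always_eventually continuous_intros continuous_cos_basis)
  then show ?thesis by (rule continuous_on_subset) simp
qed

text \<open>
  The series converges uniformly, so it may be integrated term by term, and by orthogonality it has the same
  coefficients as \<open>V\<close>. Completeness identifies the two.
\<close>

lemma AE_eq_cos_series:
  fixes V :: "real ^ 'n \<Rightarrow> real"
  assumes V: "V \<in> borel_measurable cube_measure" and B: "\<And>x. x \<in> unit_cube \<Longrightarrow> \<bar>V x\<bar> \<le> B"
    and q: "(\<lambda>m. \<bar>cos_coeff V m\<bar>) summable_on UNIV"
  shows "AE x in cube_measure. V x = cos_series (cos_coeff V) x"
proof -
  interpret finite_measure "cube_measure :: (real ^ 'n) measure" by (rule finite_measure_cube)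
  let ?q = "cos_coeff V" and ?W = "cos_series (cos_coeff V)"
  have W: "continuous_on UNIV ?W" by (rule continuous_cos_series[OF q])
  obtain B' where B': "\<And>x. x \<in> unit_cube \<Longrightarrow> \<bar>?W x\<bar> \<le> B'"
    using continuous_bounded_cube[OF W] by metis
  have intV: "integrable cube_measure V"
    by (rule integrable_const_bound[of _ B]) (use V B in auto)
  have "AE x in cube_measure. V x - ?W x = 0"
  proof (rule cos_basis_complete[where B = "B + B'"])
    show "(\<lambda>x. V x - ?W x) \<in> borel_measurable cube_measure"
      using V continuous_cube_measurable[OF W] by simp
    show "\<bar>V x - ?W x\<bar> \<le> B + B'" if "x \<in> unit_cube" for x
      using B[OF that] B'[OF that] by linarith
    fix k :: "nat ^ 'n"
    note int = integrable_mult_continuous[OF intV continuous_cos_basis[of UNIV k]]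
      integrable_continuous_cube[OF continuous_on_mult[OF W continuous_cos_basis[of UNIV k]]]
    have intm: "integrable cube_measure (\<lambda>x. c * (cos_basis m x * cos_basis k x))" for c m
      by (intro integrable_continuous_cube continuous_intros continuous_cos_basis)
    have "\<bar>LINT x|cube_measure. (V x - ?W x) * cos_basis k x\<bar> \<le> e" if "e > 0" for e
    proof -
      obtain A where A: "finite A" "{k} \<subseteq> A" "\<And>x. \<bar>?W x - (\<Sum>m\<in>A. ?q m * cos_basis m x)\<bar> < e"
        using cos_series_approx[OF q \<open>e > 0\<close>, of "{k}"] by auto
      have "(LINT x|cube_measure. (\<Sum>m\<in>A. ?q m * (cos_basis m x * cos_basis k x))) =
          (\<Sum>m\<in>A. ?q m * (LINT x|cube_measure. cos_basis m x * cos_basis k x))"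
        using intm by (simp add: Bochner_Integration.integral_sum)
      also have "\<dots> = (\<Sum>m\<in>{k}. ?q m * (LINT x|cube_measure. cos_basis m x * cos_basis k x))"
        by (rule sum.mono_neutral_right) (use A cos_basis_orthogonal in auto)
      also have "\<dots> = (LINT x|cube_measure. V x * cos_basis k x)"
        unfolding cos_coeff_eq[of V k] by (simp add: power2_eq_square)
      finally have VA: "(LINT x|cube_measure. V x * cos_basis k x) =
          (LINT x|cube_measure. (\<Sum>m\<in>A. ?q m * (cos_basis m x * cos_basis k x)))" ..
      have intA: "integrable cube_measure (\<lambda>x. \<Sum>m\<in>A. ?q m * (cos_basis m x * cos_basis k x))"
        by (intro Bochner_Integration.integrable_sum intm)
      have "(LINT x|cube_measure. (V x - ?W x) * cos_basis k x) =
          (LINT x|cube_measure. V x * cos_basis k x) - (LINT x|cube_measure. ?W x * cos_basis k x)"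
        using int by (simp add: left_diff_distrib)
      also have "\<dots> = (LINT x|cube_measure. (\<Sum>m\<in>A. ?q m * (cos_basis m x * cos_basis k x)) - ?W x * cos_basis k x)"
        unfolding VA using int intA by simp
      also have "\<bar>\<dots>\<bar> \<le> (LINT x|cube_measure. \<bar>(\<Sum>m\<in>A. ?q m * (cos_basis m x * cos_basis k x)) - ?W x * cos_basis k x\<bar>)"
        by (rule integral_abs_bound)
      also have "\<dots> \<le> (LINT x|(cube_measure :: (real ^ 'n) measure). e)"
      proof (rule integral_mono)
        fix x :: "real ^ 'n"
        have "(\<Sum>m\<in>A. ?q m * (cos_basis m x * cos_basis k x)) - ?W x * cos_basis k x =
            ((\<Sum>m\<in>A. ?q m * cos_basis m x) - ?W x) * cos_basis k x"
          by (simp add: left_diff_distrib sum_distrib_right mult.assoc)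
        also have "\<bar>\<dots>\<bar> \<le> e * 1"
          unfolding abs_mult using A(3)[of x] cos_basis_bound[of k x] \<open>e > 0\<close>
          by (intro mult_mono) (auto simp: abs_minus_commute)
        finally show "\<bar>(\<Sum>m\<in>A. ?q m * (cos_basis m x * cos_basis k x)) - ?W x * cos_basis k x\<bar> \<le> e" by simp
      qed (use int intA in auto)
      also have "\<dots> = e" by (simp add: measure_cube)
      finally show ?thesis .
    qed
    then show "(LINT x|cube_measure. (V x - ?W x) * cos_basis k x) = 0"
      using field_le_epsilon[of "\<bar>LINT x|cube_measure. (V x - ?W x) * cos_basis k x\<bar>" 0] by simp
  qed
  then show ?thesis by simp
qed

text \<open>
  Multiplication by \<open>V\<close> acts on moments as a convolution with its coefficients. The bound is obtained from
  partial sums of the series of \<open>V\<close>, whose error is uniformly small, and then passing to the limit.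
\<close>

lemma abs_moment_mult_le:
  fixes V u :: "real ^ 'n \<Rightarrow> real"
  assumes V: "AE x in cube_measure. V x = cos_series q x"
    and q: "(\<lambda>m. \<bar>q m\<bar>) summable_on UNIV"
    and u: "integrable cube_measure u"
    and meas: "V \<in> borel_measurable cube_measure"
    and summ: "(\<lambda>(\<sigma>, m). \<bar>q m\<bar> / 2 ^ CARD('n) * \<bar>moment u (k + signed_index \<sigma> m)\<bar>) summable_on UNIV"
  shows "\<bar>LINT x|cube_measure. V x * u x * cos_mode k x\<bar> \<le>
    (\<Sum>\<^sub>\<infinity>(\<sigma>, m). \<bar>q m\<bar> / 2 ^ CARD('n) * \<bar>moment u (k + signed_index \<sigma> m)\<bar>)"
    (is "?L \<le> ?R")
proof -
  let ?W = "cos_series q"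
  have W: "continuous_on UNIV ?W" by (rule continuous_cos_series[OF q])
  let ?U = "LINT x|cube_measure. \<bar>u x\<bar>"
  have "(LINT x|cube_measure. V x * u x * cos_mode k x) = (LINT x|cube_measure. ?W x * u x * cos_mode k x)"
    by (rule integral_cong_AE) (use V meas u continuous_cube_measurable[OF W]
        continuous_cube_measurable[OF continuous_modes(1)[of _ k]] in auto)
  have int: "integrable cube_measure (\<lambda>x. ?W x * u x * cos_mode k x)"
    using integrable_mult_continuous[OF u continuous_on_mult[OF W continuous_modes(1)[of _ k]]]
    by (simp add: mult_ac)
  have intm: "integrable cube_measure (\<lambda>x. c * (u x * (cos_mode k x * cos_basis m x)))" for c m
    by (intro integrable_mult_right integrable_mult_continuous u continuous_intros
        continuous_modes continuous_cos_basis)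
  have *: "\<bar>LINT x|cube_measure. ?W x * u x * cos_mode k x\<bar> \<le> ?R + e * ?U" if "e > 0" for e
  proof -
    obtain A where A: "finite A" "\<And>x. \<bar>?W x - (\<Sum>m\<in>A. q m * cos_basis m x)\<bar> < e"
      using cos_series_approx[OF q \<open>e > 0\<close>, of "{}"] by auto
    let ?P = "\<lambda>x. \<Sum>m\<in>A. q m * (u x * (cos_mode k x * cos_basis m x))"
    have intA: "integrable cube_measure ?P"
      by (intro Bochner_Integration.integrable_sum intm)
    have "(LINT x|cube_measure. ?P x) = (\<Sum>m\<in>A. q m * ((\<Sum>\<sigma>\<in>UNIV. moment u (k + signed_index \<sigma> m)) / 2 ^ CARD('n)))"
      using intm by (simp add: Bochner_Integration.integral_sum moment_mult_basis[OF u])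
    also have "\<bar>\<dots>\<bar> \<le> (\<Sum>m\<in>A. \<Sum>\<sigma>\<in>UNIV. \<bar>q m\<bar> / 2 ^ CARD('n) * \<bar>moment u (k + signed_index \<sigma> m)\<bar>)"
    proof (rule order_trans[OF sum_abs sum_mono])
      fix m
      have "\<bar>\<Sum>\<sigma>\<in>UNIV. moment u (k + signed_index \<sigma> m)\<bar> \<le> (\<Sum>\<sigma>\<in>UNIV. \<bar>moment u (k + signed_index \<sigma> m)\<bar>)"
        by (rule sum_abs)
      then have "\<bar>q m\<bar> / 2 ^ CARD('n) * \<bar>\<Sum>\<sigma>\<in>UNIV. moment u (k + signed_index \<sigma> m)\<bar> \<le>
          \<bar>q m\<bar> / 2 ^ CARD('n) * (\<Sum>\<sigma>\<in>UNIV. \<bar>moment u (k + signed_index \<sigma> m)\<bar>)"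
        by (rule mult_left_mono) simp
      moreover have "\<bar>q m * ((\<Sum>\<sigma>\<in>UNIV. moment u (k + signed_index \<sigma> m)) / 2 ^ CARD('n))\<bar> =
          \<bar>q m\<bar> / 2 ^ CARD('n) * \<bar>\<Sum>\<sigma>\<in>UNIV. moment u (k + signed_index \<sigma> m)\<bar>"
        by (simp add: abs_mult)
      ultimately show "\<bar>q m * ((\<Sum>\<sigma>\<in>UNIV. moment u (k + signed_index \<sigma> m)) / 2 ^ CARD('n))\<bar> \<le>
          (\<Sum>\<sigma>\<in>UNIV. \<bar>q m\<bar> / 2 ^ CARD('n) * \<bar>moment u (k + signed_index \<sigma> m)\<bar>)"
        unfolding sum_distrib_left[symmetric] by linarith
    qed
    also have "\<dots> = (\<Sum>(\<sigma>, m)\<in>UNIV \<times> A. \<bar>q m\<bar> / 2 ^ CARD('n) * \<bar>moment u (k + signed_index \<sigma> m)\<bar>)"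
      by (subst sum.swap) (simp add: sum.cartesian_product)
    also have "\<dots> \<le> ?R"
      by (rule finite_sum_le_infsum[OF summ]) (use A in auto)
    finally have P: "\<bar>LINT x|cube_measure. ?P x\<bar> \<le> ?R" .
    have "\<bar>LINT x|cube_measure. ?W x * u x * cos_mode k x - ?P x\<bar> \<le>
        (LINT x|cube_measure. \<bar>?W x * u x * cos_mode k x - ?P x\<bar>)"
      by (rule integral_abs_bound)
    also have "\<dots> \<le> (LINT x|cube_measure. e * \<bar>u x\<bar>)"
    proof (rule integral_mono)
      fix x :: "real ^ 'n"
      have "?W x * u x * cos_mode k x - ?P x = (?W x - (\<Sum>m\<in>A. q m * cos_basis m x)) * (u x * cos_mode k x)"
        by (simp add: algebra_simps sum_distrib_left)
      also have "\<bar>\<dots>\<bar> \<le> e * (\<bar>u x\<bar> * 1)"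
        unfolding abs_mult using A(2)[of x] cos_mode_bound[of k x] \<open>e > 0\<close>
        by (intro mult_mono) auto
      finally show "\<bar>?W x * u x * cos_mode k x - ?P x\<bar> \<le> e * \<bar>u x\<bar>" by simp
    qed (use int intA u in auto)
    also have "\<dots> = e * ?U" by simp
    finally show ?thesis using P int intA by simp
  qed
  define U where "U = ?U"
  have U0: "0 \<le> U" by (simp add: U_def)
  have "?L \<le> ?R + e" if "e > 0" for e
  proof -
    \<comment> \<open>The summand 1 covers the case that \<open>u\<close> vanishes.\<close>
    have "e / (U + 1) > 0" "e / (U + 1) * U \<le> e"
      using that U0 by (auto simp: field_simps)
    with *[of "e / (U + 1)", folded U_def] show ?thesis
      using \<open>(LINT x|cube_measure. V x * u x * cos_mode k x) = _\<close> by linarith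
  qed
  then show ?thesis by (rule field_le_epsilon)
qed

section \<open>The eigenvalue equation of the ground state\<close>

lemma square_integrable_imp_integrable:
  fixes f :: "real ^ 'n \<Rightarrow> 'b :: euclidean_space"
  assumes "square_integrable f" shows "integrable cube_measure f"
proof -
  interpret finite_measure "cube_measure :: (real ^ 'n) measure" by (rule finite_measure_cube)
  show ?thesis
  proof (rule Bochner_Integration.integrable_bound)
    show "integrable cube_measure (\<lambda>x. 1 + (norm (f x))\<^sup>2)"
      using assms by (auto simp: square_integrable_def)
    have "norm (f x) \<le> 1 + (norm (f x))\<^sup>2" for x
      using sum_power2_ge_zero[of "norm (f x) - 1" 0] zero_le_power2[of "norm (f x) - 1"]
      by (simp add: power2_diff) (smt (verit) zero_le_power2)
    then show "AE x in cube_measure. norm (f x) \<le> norm (1 + (norm (f x))\<^sup>2)"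
      by (auto intro!: AE_I2 order_trans[OF _ abs_ge_self])
  qed (use assms in \<open>auto simp: square_integrable_def\<close>)
qed

lemma square_integrable_add_scaled:
  fixes f g :: "real ^ 'n \<Rightarrow> 'b :: euclidean_space"
  assumes f: "square_integrable f" and g: "square_integrable g"
  shows "square_integrable (\<lambda>x. f x + t *\<^sub>R g x)"
  unfolding square_integrable_def
proof
  show m: "(\<lambda>x. f x + t *\<^sub>R g x) \<in> borel_measurable cube_measure"
    using f g by (auto simp: square_integrable_def)
  show "integrable cube_measure (\<lambda>x. (norm (f x + t *\<^sub>R g x))\<^sup>2)"
  proof (rule Bochner_Integration.integrable_bound)
    show "integrable cube_measure (\<lambda>x. 2 * (norm (f x))\<^sup>2 + 2 * t\<^sup>2 * (norm (g x))\<^sup>2)"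
      using f g by (auto simp: square_integrable_def)
    show "(\<lambda>x. (norm (f x + t *\<^sub>R g x))\<^sup>2) \<in> borel_measurable cube_measure" using m by simp
    have "(norm (f x + t *\<^sub>R g x))\<^sup>2 \<le> 2 * (norm (f x))\<^sup>2 + 2 * t\<^sup>2 * (norm (g x))\<^sup>2" for x
    proof -
      have "(norm (f x + t *\<^sub>R g x))\<^sup>2 \<le> (norm (f x) + norm (t *\<^sub>R g x))\<^sup>2"
        by (intro power_mono norm_triangle_ineq) simp
      also have "\<dots> \<le> 2 * (norm (f x))\<^sup>2 + 2 * (norm (t *\<^sub>R g x))\<^sup>2"
        using sum_squares_bound[of "norm (f x)" "norm (t *\<^sub>R g x)"] by (simp add: power2_sum)
      finally show ?thesis by (simp add: power_mult_distrib)
    qed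
    then show "AE x in cube_measure. norm ((norm (f x + t *\<^sub>R g x))\<^sup>2) \<le>
        norm (2 * (norm (f x))\<^sup>2 + 2 * t\<^sup>2 * (norm (g x))\<^sup>2)"
      by (auto intro!: AE_I2)
  qed
qed

lemma has_H1_gradient_add_scaled:
  assumes f: "has_H1_gradient f F" and g: "has_H1_gradient g G"
  shows "has_H1_gradient (\<lambda>x. f x + t * g x) (\<lambda>x. F x + t *\<^sub>R G x)"
  unfolding has_H1_gradient_def
proof (intro conjI)
  show "square_integrable (\<lambda>x. f x + t * g x)" "square_integrable (\<lambda>x. F x + t *\<^sub>R G x)"
    using square_integrable_add_scaled[of f g t] square_integrable_add_scaled[of F G t] f g
    by (auto simp: has_H1_gradient_def)
  show "has_weak_gradient (\<lambda>x. f x + t * g x) (\<lambda>x. F x + t *\<^sub>R G x)"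
    unfolding has_weak_gradient_def
  proof (intro allI impI)
    fix \<phi> :: "real ^ 'a \<Rightarrow> real" and i
    assume \<phi>: "test_function \<phi>"
    then have "Ck 0 \<phi>" "Ck 1 \<phi>" by (simp_all only: test_function_def)
    then have c: "continuous_on UNIV \<phi>" "continuous_on UNIV (partial_deriv i \<phi>)" by auto
    have int: "integrable cube_measure f" "integrable cube_measure g"
        "integrable cube_measure F" "integrable cube_measure G"
      using f g by (auto simp: has_H1_gradient_def intro: square_integrable_imp_integrable)
    then have int': "integrable cube_measure (\<lambda>x. F x $ i)" "integrable cube_measure (\<lambda>x. G x $ i)"
      using integrable_bounded_linear[OF bounded_linear_vec_nth] by blast+
    have wf: "(LINT x|cube_measure. f x * partial_deriv i \<phi> x) = - (LINT x|cube_measure. F x $ i * \<phi> x)"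
      and wg: "(LINT x|cube_measure. g x * partial_deriv i \<phi> x) = - (LINT x|cube_measure. G x $ i * \<phi> x)"
      using f g \<phi> by (auto simp: has_H1_gradient_def has_weak_gradient_def)
    have "(LINT x|cube_measure. (f x + t * g x) * partial_deriv i \<phi> x) =
        (LINT x|cube_measure. f x * partial_deriv i \<phi> x) + t * (LINT x|cube_measure. g x * partial_deriv i \<phi> x)"
      using integrable_mult_continuous[OF int(1) c(2)] integrable_mult_continuous[OF int(2) c(2)]
      by (simp add: distrib_right mult.assoc)
    also have "\<dots> = - (LINT x|cube_measure. (F x + t *\<^sub>R G x) $ i * \<phi> x)"
      using integrable_mult_continuous[OF int'(1) c(1)] integrable_mult_continuous[OF int'(2) c(1)]
      by (simp add: distrib_right mult.assoc wf wg)
    finally show "(LINT x|cube_measure. (f x + t * g x) * partial_deriv i \<phi> x) =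
      - (LINT x|cube_measure. (F x + t *\<^sub>R G x) $ i * \<phi> x)" .
  qed
qed

text \<open>
  At \<open>t = - b / (\<bar>a\<bar> + 1)\<close> the linear term outweighs the quadratic one unless \<open>b = 0\<close>.
\<close>

lemma linear_coeff_eq_0_if_quadratic_nonneg:
  fixes a b :: real
  assumes "\<And>t. 0 \<le> 2 * t * b + t\<^sup>2 * a" shows "b = 0"
proof (rule ccontr)
  assume "b \<noteq> 0"
  define p where "p = \<bar>a\<bar> + 1"
  define t where "t = - b / p"
  have p: "p > 0" "a \<le> p" by (auto simp: p_def)
  have "t\<^sup>2 * a \<le> t\<^sup>2 * p" by (intro mult_left_mono p) auto
  also have "\<dots> = b\<^sup>2 / p" using p(1) by (simp add: t_def power2_eq_square)
  finally have "0 \<le> 2 * t * b + b\<^sup>2 / p" using assms[of t] by simp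
  moreover have "t * b = - (b\<^sup>2 / p)" by (simp add: t_def power2_eq_square)
  moreover have "b\<^sup>2 / p > 0" using p(1) \<open>b \<noteq> 0\<close> by simp
  ultimately show False by simp
qed

text \<open>
  The Euler--Lagrange equation of the Rayleigh quotient. For the competitor \<open>u + t v\<close>, minimality says that a
  quadratic polynomial in \<open>t\<close> without constant term is nonnegative, so its linear coefficient is zero.
  The multiplier \<open>\<mu>\<close> is the lowest eigenvalue.
\<close>

lemma ground_state_weak_equation:
  fixes V u :: "real ^ 'n \<Rightarrow> real"
  assumes gs: "ground_state V u" and V: "V \<in> borel_measurable cube_measure"
    and B: "\<And>x. x \<in> unit_cube \<Longrightarrow> \<bar>V x\<bar> \<le> B"
  obtains g \<mu> where "has_H1_gradient u g"
    and "\<And>v G. has_H1_gradient v G \<Longrightarrow> continuous_on UNIV v \<Longrightarrow> continuous_on UNIV G \<Longrightarrow>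
      (LINT x|cube_measure. g x \<bullet> G x) + (LINT x|cube_measure. V x * u x * v x) =
      \<mu> * (LINT x|cube_measure. u x * v x)"
proof -
  from gs obtain g where ug: "has_H1_gradient u g" and norm: "(LINT x|cube_measure. (u x)\<^sup>2) = 1"
    and min': "\<forall>w h. has_H1_gradient w h \<and> \<not> (AE x in cube_measure. w x = 0) \<longrightarrow>
        rayleigh_quotient V u g \<le> rayleigh_quotient V w h"
    unfolding ground_state_def by (elim exE conjE) (rule that)
  have min: "rayleigh_quotient V u g \<le> rayleigh_quotient V w h"
    if "has_H1_gradient w h" "\<not> (AE x in cube_measure. w x = 0)" for w h
    using min' that by blast
  define \<mu> where "\<mu> = rayleigh_quotient V u g"
  have intV: "integrable cube_measure (\<lambda>x. f x * V x)" if "integrable cube_measure f" for f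
    by (rule integrable_mult_bounded[OF that V]) (use B in auto)
  have sq: "integrable cube_measure (\<lambda>x. (w x)\<^sup>2)" "integrable cube_measure (\<lambda>x. (norm (h x))\<^sup>2)"
    "integrable cube_measure w" "integrable cube_measure h"
    if "has_H1_gradient w h" for w :: "real ^ 'n \<Rightarrow> real" and h
  proof -
    have wh: "square_integrable w" "square_integrable h"
      using that by (simp_all add: has_H1_gradient_def)
    show "integrable cube_measure w" "integrable cube_measure h"
      by (rule square_integrable_imp_integrable, rule wh)+
    show "integrable cube_measure (\<lambda>x. (w x)\<^sup>2)" "integrable cube_measure (\<lambda>x. (norm (h x))\<^sup>2)"
      using wh[unfolded square_integrable_def] unfolding real_norm_def power2_abs by blast+
  qed
  \<comment> \<open>Cleared of its denominator, minimality also holds for competitors that vanish almost everywhere.\<close>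
  have lower: "\<mu> * (LINT x|cube_measure. (w x)\<^sup>2) \<le> (LINT x|cube_measure. (norm (h x))\<^sup>2 + V x * (w x)\<^sup>2)"
    if wh: "has_H1_gradient w h" for w h
  proof (cases "AE x in cube_measure. w x = 0")
    case True
    have wm: "w \<in> borel_measurable cube_measure" using sq(3)[OF wh] by simp
    have "(LINT x|cube_measure. (w x)\<^sup>2) = (LINT x|(cube_measure :: (real ^ 'n) measure). 0)"
      by (rule integral_cong_AE) (use True wm in auto)
    moreover have "(LINT x|cube_measure. (norm (h x))\<^sup>2 + V x * (w x)\<^sup>2) = (LINT x|cube_measure. (norm (h x))\<^sup>2)"
      by (rule integral_cong_AE) (use True wm V sq(2,4)[OF wh] in auto)
    ultimately show ?thesis by simp
  next
    case False
    have "(LINT x|cube_measure. (w x)\<^sup>2) \<noteq> 0"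
      using False sq(1)[OF wh] by (subst integral_nonneg_eq_0_iff_AE) auto
    then have "(LINT x|cube_measure. (w x)\<^sup>2) > 0" by (simp add: less_le)
    then show ?thesis
      using min[OF wh False] by (simp add: \<mu>_def[symmetric] rayleigh_quotient_def[of V w] pos_le_divide_eq)
  qed
  have \<mu>: "\<mu> = (LINT x|cube_measure. (norm (g x))\<^sup>2) + (LINT x|cube_measure. V x * (u x)\<^sup>2)"
    unfolding \<mu>_def rayleigh_quotient_def norm
    using sq[OF ug] intV[of "\<lambda>x. (u x)\<^sup>2"] by (simp add: mult.commute)
  have "(LINT x|cube_measure. g x \<bullet> G x) + (LINT x|cube_measure. V x * u x * v x) =
      \<mu> * (LINT x|cube_measure. u x * v x)"
    if vG: "has_H1_gradient v G" and c: "continuous_on UNIV v" "continuous_on UNIV G" for v G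
  proof -
    let ?I = "\<lambda>f. LINT x|(cube_measure :: (real ^ 'n) measure). f x"
    have i1: "integrable cube_measure (\<lambda>x. g x \<bullet> G x)"
    proof -
      have "integrable cube_measure (\<lambda>x. g x $ i * G x $ i)" for i
        by (intro integrable_mult_continuous continuous_intros c
            integrable_bounded_linear[OF bounded_linear_vec_nth] sq(4)[OF ug])
      then show ?thesis unfolding inner_vec_def by simp
    qed
    have i2: "integrable cube_measure (\<lambda>x. u x * v x)"
      by (rule integrable_mult_continuous[OF sq(3)[OF ug] c(1)])
    have i3: "integrable cube_measure (\<lambda>x. V x * u x * v x)"
      using intV[OF i2] by (simp add: mult_ac)
    have i4: "integrable cube_measure (\<lambda>x. V x * (u x)\<^sup>2)" "integrable cube_measure (\<lambda>x. V x * (v x)\<^sup>2)"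
      using intV[OF sq(1)[OF ug]] intV[OF sq(1)[OF vG]] by (simp_all add: mult_ac)
    let ?a = "?I (\<lambda>x. (norm (G x))\<^sup>2) + ?I (\<lambda>x. V x * (v x)\<^sup>2) - \<mu> * ?I (\<lambda>x. (v x)\<^sup>2)"
    let ?b = "?I (\<lambda>x. g x \<bullet> G x) + ?I (\<lambda>x. V x * u x * v x) - \<mu> * ?I (\<lambda>x. u x * v x)"
    have "0 \<le> 2 * t * ?b + t\<^sup>2 * ?a" for t
    proof -
      have e1: "(norm (g x + t *\<^sub>R G x))\<^sup>2 + V x * (u x + t * v x)\<^sup>2 =
          (norm (g x))\<^sup>2 + V x * (u x)\<^sup>2 + 2 * t * (g x \<bullet> G x) + 2 * t * (V x * u x * v x)
          + t\<^sup>2 * (norm (G x))\<^sup>2 + t\<^sup>2 * (V x * (v x)\<^sup>2)" for x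
        unfolding power2_norm_eq_inner
        by (simp add: inner_add_left inner_add_right inner_commute[of "G x" "g x"]
            power2_eq_square algebra_simps)
      have e2: "(u x + t * v x)\<^sup>2 = (u x)\<^sup>2 + 2 * t * (u x * v x) + t\<^sup>2 * (v x)\<^sup>2" for x
        by (simp add: power2_eq_square algebra_simps)
      have "\<mu> * (1 + 2 * t * ?I (\<lambda>x. u x * v x) + t\<^sup>2 * ?I (\<lambda>x. (v x)\<^sup>2)) \<le>
          ?I (\<lambda>x. (norm (g x))\<^sup>2) + ?I (\<lambda>x. V x * (u x)\<^sup>2) + 2 * t * ?I (\<lambda>x. g x \<bullet> G x)
          + 2 * t * ?I (\<lambda>x. V x * u x * v x) + t\<^sup>2 * ?I (\<lambda>x. (norm (G x))\<^sup>2) + t\<^sup>2 * ?I (\<lambda>x. V x * (v x)\<^sup>2)"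
        using lower[OF has_H1_gradient_add_scaled[OF ug vG, of t], unfolded e1, unfolded e2]
          sq[OF ug] sq[OF vG] i1 i2 i3 i4
        by (simp add: norm)
      then show ?thesis using \<mu> by (simp add: algebra_simps)
    qed
    then have "?b = 0" by (rule linear_coeff_eq_0_if_quadratic_nonneg)
    then show ?thesis by simp
  qed
  then show ?thesis using that ug by blast
qed

text \<open>
  The eigenvalue equation tested with a cosine mode. Two partial integrations would be needed to move the
  Laplacian to the mode; one of them is the weak equation and the other is
  \<open>weak_gradient_against_sin_mode\<close>.
\<close>

lemma ground_state_moment_equation:
  fixes V u :: "real ^ 'n \<Rightarrow> real"
  assumes "ground_state V u" "V \<in> borel_measurable cube_measure"
    "\<And>x. x \<in> unit_cube \<Longrightarrow> \<bar>V x\<bar> \<le> B"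
  obtains \<mu> where "integrable cube_measure u"
    "\<And>k. pi\<^sup>2 * (\<Sum>i\<in>UNIV. (real_of_int (k $ i))\<^sup>2) * moment u k =
      \<mu> * moment u k - (LINT x|cube_measure. V x * u x * cos_mode k x)"
proof -
  obtain g \<mu> where ug: "has_H1_gradient u g" and weak:
    "\<And>v G. has_H1_gradient v G \<Longrightarrow> continuous_on UNIV v \<Longrightarrow> continuous_on UNIV G \<Longrightarrow>
      (LINT x|cube_measure. g x \<bullet> G x) + (LINT x|cube_measure. V x * u x * v x) =
      \<mu> * (LINT x|cube_measure. u x * v x)"
    using ground_state_weak_equation[OF assms] by blast
  have sq: "square_integrable u" "square_integrable g"
    using ug by (simp_all add: has_H1_gradient_def)
  note u = square_integrable_imp_integrable[OF sq(1)]
  have g: "integrable cube_measure (\<lambda>x. g x $ i)" for i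
    by (rule integrable_bounded_linear[OF bounded_linear_vec_nth square_integrable_imp_integrable[OF sq(2)]])
  have "pi\<^sup>2 * (\<Sum>i\<in>UNIV. (real_of_int (k $ i))\<^sup>2) * moment u k =
      \<mu> * moment u k - (LINT x|cube_measure. V x * u x * cos_mode k x)" for k
  proof -
    have "integrable cube_measure (\<lambda>x. g x $ i * sin_mode i k x)" for i
      by (rule integrable_mult_continuous[OF g continuous_modes(2)])
    then have "(LINT x|cube_measure. g x \<bullet> cos_mode_gradient k x) =
        (\<Sum>i\<in>UNIV. - (pi * of_int (k $ i)) * (LINT x|cube_measure. g x $ i * sin_mode i k x))"
      by (simp add: inner_vec_def cos_mode_gradient_def mult.left_commute[of "g _ $ _"] Bochner_Integration.integral_sum)
    also have "\<dots> = (\<Sum>i\<in>UNIV. - (pi * of_int (k $ i)) * (- (pi * of_int (k $ i)) * moment u k))"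
      using weak_gradient_against_sin_mode[OF _ u g] ug by (simp add: has_H1_gradient_def moment_def)
    also have "\<dots> = pi\<^sup>2 * (\<Sum>i\<in>UNIV. (real_of_int (k $ i))\<^sup>2) * moment u k"
      by (simp add: sum_distrib_left sum_distrib_right power2_eq_square mult_ac)
    finally show ?thesis
      using weak[OF cos_mode_H1 continuous_modes(1) continuous_cos_mode_gradient, of k]
      by (simp add: moment_def)
  qed
  then show ?thesis using that u by blast
qed

section \<open>Elliptic regularity on a lattice\<close>

definition shift_sum :: "('j \<Rightarrow> 'a::ab_group_add) \<Rightarrow> ('j \<Rightarrow> ennreal) \<Rightarrow> ('a \<Rightarrow> ennreal) \<Rightarrow> 'a \<Rightarrow> ennreal" where
  "shift_sum h c v k = (\<integral>\<^sup>+j. c j * v (k + h j) \<partial>count_space UNIV)"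

lemma shift_sum_mono: "(\<And>k. v k \<le> v' k) \<Longrightarrow> shift_sum h c v k \<le> shift_sum h c v' k"
  unfolding shift_sum_def by (intro nn_integral_mono mult_left_mono) auto

lemma shift_sum_add_const:
  "shift_sum h c (\<lambda>k. v k + a) k = shift_sum h c v k + (\<integral>\<^sup>+j. c j \<partial>count_space UNIV) * a"
  unfolding shift_sum_def
  by (simp add: distrib_left nn_integral_add nn_integral_multc)

text \<open>
  Young's inequality for a weighted \<open>\<ell>\<^sup>1\<close> space: a submultiplicative weight is passed on to the kernel and to the
  translated sequence, and the translation is a bijection of the group.
\<close>

lemma weighted_shift_sum_le:
  fixes h :: "'j :: countable \<Rightarrow> 'a :: {ab_group_add, countable}" and w :: "'a \<Rightarrow> ennreal"
  assumes w: "\<And>k j. w k \<le> w (k + h j) * w' j"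
  shows "(\<integral>\<^sup>+k. w k * shift_sum h c v k \<partial>count_space UNIV) \<le>
    (\<integral>\<^sup>+j. c j * w' j \<partial>count_space UNIV) * (\<integral>\<^sup>+k. w k * v k \<partial>count_space UNIV)"
proof -
  interpret pair_sigma_finite "count_space (UNIV :: 'a set)" "count_space (UNIV :: 'j set)"
    by (intro pair_sigma_finite.intro sigma_finite_measure_count_space)
  have "(\<integral>\<^sup>+k. w k * shift_sum h c v k \<partial>count_space UNIV) =
      (\<integral>\<^sup>+k. \<integral>\<^sup>+j. w k * (c j * v (k + h j)) \<partial>count_space UNIV \<partial>count_space UNIV)"
    by (simp add: shift_sum_def nn_integral_cmult)
  also have "\<dots> = (\<integral>\<^sup>+j. \<integral>\<^sup>+k. w k * (c j * v (k + h j)) \<partial>count_space UNIV \<partial>count_space UNIV)"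
    by (rule Fubini'[symmetric]) (simp add: pair_measure_countable)
  also have "\<dots> \<le> (\<integral>\<^sup>+j. \<integral>\<^sup>+k. (c j * w' j) * (w (k + h j) * v (k + h j)) \<partial>count_space UNIV \<partial>count_space UNIV)"
  proof (intro nn_integral_mono)
    fix j k
    have "w k * (c j * v (k + h j)) \<le> (w (k + h j) * w' j) * (c j * v (k + h j))"
      by (intro mult_right_mono w) auto
    then show "w k * (c j * v (k + h j)) \<le> (c j * w' j) * (w (k + h j) * v (k + h j))"
      by (simp add: mult_ac)
  qed
  also have "\<dots> = (\<integral>\<^sup>+j. (c j * w' j) * (\<integral>\<^sup>+k. w k * v k \<partial>count_space UNIV) \<partial>count_space UNIV)"
  proof (intro nn_integral_cong)
    fix j
    have "bij (\<lambda>k. k + h j)" by (rule bij_plus_right)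
    from nn_integral_bij_count_space[OF this, of "\<lambda>k. w k * v k"]
    show "(\<integral>\<^sup>+k. (c j * w' j) * (w (k + h j) * v (k + h j)) \<partial>count_space UNIV) =
        (c j * w' j) * (\<integral>\<^sup>+k. w k * v k \<partial>count_space UNIV)"
      by (simp add: nn_integral_cmult)
  qed
  also have "\<dots> = (\<integral>\<^sup>+j. c j * w' j \<partial>count_space UNIV) * (\<integral>\<^sup>+k. w k * v k \<partial>count_space UNIV)"
    by (simp add: nn_integral_multc)
  finally show ?thesis .
qed

text \<open>
  Iterating \<open>v \<mapsto> T v + F\<close> from 0 gives an increasing sequence \<open>G n\<close>. It is bounded in weighted \<open>\<ell>\<^sup>1\<close> because
  \<open>T\<close> halves that norm, and \<open>b \<le> G n + M / 2 ^ n\<close> because \<open>T\<close> halves the sup norm as well. So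
  boundedness of \<open>b\<close> is enough to dominate it by the weighted summable limit of the iteration. Extended
  nonnegative reals make all sums meaningful before any of them is known to be finite.
\<close>

lemma contraction_bound:
  fixes b F :: "'a \<Rightarrow> ennreal" and T :: "('a \<Rightarrow> ennreal) \<Rightarrow> 'a \<Rightarrow> ennreal"
  assumes b: "\<And>k. b k \<le> ennreal M" and "0 \<le> M"
    and bT: "\<And>k. b k \<le> T b k + F k"
    and mono: "\<And>v v' k. (\<And>k. v k \<le> v' k) \<Longrightarrow> T v k \<le> T v' k"
    and sup: "\<And>v a k. T (\<lambda>k. v k + a) k \<le> T v k + ennreal (1 / 2) * a"
    and l1: "\<And>v. (\<integral>\<^sup>+k. w k * T v k \<partial>count_space UNIV) \<le>
      ennreal (1 / 2) * (\<integral>\<^sup>+k. w k * v k \<partial>count_space UNIV)"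
  shows "(\<integral>\<^sup>+k. w k * b k \<partial>count_space UNIV) \<le> 2 * (\<integral>\<^sup>+k. w k * F k \<partial>count_space UNIV)"
proof -
  define G where "G n = ((\<lambda>v k. T v k + F k) ^^ n) (\<lambda>_. 0)" for n
  have G0: "G 0 = (\<lambda>_. 0)" and GSuc: "G (Suc n) = (\<lambda>k. T (G n) k + F k)" for n
    by (simp_all add: G_def)
  let ?S = "\<integral>\<^sup>+k. w k * F k \<partial>count_space UNIV"
  have GS: "(\<integral>\<^sup>+k. w k * G n k \<partial>count_space UNIV) \<le> 2 * ?S" for n
  proof (induction n)
    case (Suc n)
    have "(\<integral>\<^sup>+k. w k * G (Suc n) k \<partial>count_space UNIV) =
      (\<integral>\<^sup>+k. w k * T (G n) k \<partial>count_space UNIV) + ?S"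
      by (simp add: GSuc distrib_left nn_integral_add)
    also have "\<dots> \<le> ennreal (1 / 2) * (2 * ?S) + ?S"
      by (intro add_mono order_trans[OF l1] mult_left_mono Suc order_refl) auto
    also have "ennreal (1 / 2) * (2 * ?S) = (ennreal (1 / 2) * ennreal 2) * ?S"
      by (simp add: mult.assoc)
    also have "ennreal (1 / 2) * ennreal 2 = 1"
      by (subst ennreal_mult[symmetric]) auto
    finally show ?case by (simp add: mult_2)
  qed (simp add: G0)
  have bG: "b k \<le> G n k + ennreal (M / 2 ^ n)" for n k
  proof (induction n arbitrary: k)
    case (Suc n)
    have "b k \<le> T (\<lambda>k. G n k + ennreal (M / 2 ^ n)) k + F k"
      by (rule order_trans[OF bT add_right_mono[OF mono[OF Suc]]])
    also have "\<dots> \<le> T (G n) k + ennreal (1 / 2) * ennreal (M / 2 ^ n) + F k"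
      by (intro add_right_mono sup)
    also have "ennreal (1 / 2) * ennreal (M / 2 ^ n) = ennreal (M / 2 ^ Suc n)"
      using \<open>0 \<le> M\<close> by (subst ennreal_mult[symmetric]) auto
    finally show ?case by (simp add: GSuc add_ac)
  qed (simp add: G0 b)
  have "G n k \<le> G (Suc n) k" for n k
    by (induction n arbitrary: k) (auto simp: G0 GSuc intro!: add_right_mono mono)
  then have inc: "incseq G" by (auto simp: incseq_Suc_iff le_fun_def)
  have bSUP: "b k \<le> (SUP n. G n k)" for k
  proof (rule LIMSEQ_le_const)
    have "(\<lambda>n. M / 2 ^ n) \<longlonglongrightarrow> 0" by (rule LIMSEQ_divide_realpow_zero) simp
    then have "(\<lambda>n. (SUP n. G n k) + ennreal (M / 2 ^ n)) \<longlonglongrightarrow> (SUP n. G n k) + ennreal 0"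
      by (intro tendsto_add tendsto_const tendsto_ennrealI)
    then show "(\<lambda>n. (SUP n. G n k) + ennreal (M / 2 ^ n)) \<longlonglongrightarrow> (SUP n. G n k)" by simp
    have "b k \<le> (SUP n. G n k) + ennreal (M / 2 ^ n)" for n
      by (rule order_trans[OF bG[of k n]]) (intro add_right_mono SUP_upper UNIV_I)
    then show "\<exists>N. \<forall>n\<ge>N. b k \<le> (SUP n. G n k) + ennreal (M / 2 ^ n)" by blast
  qed
  have "(\<integral>\<^sup>+k. w k * b k \<partial>count_space UNIV) \<le> (\<integral>\<^sup>+k. (SUP n. w k * G n k) \<partial>count_space UNIV)"
    by (intro nn_integral_mono) (simp add: bSUP mult_left_mono flip: SUP_mult_left_ennreal)
  also have "\<dots> = (SUP n. \<integral>\<^sup>+k. w k * G n k \<partial>count_space UNIV)"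
    using inc by (intro nn_integral_monotone_convergence_SUP) (auto simp: incseq_def le_fun_def mult_left_mono)
  also have "\<dots> \<le> 2 * ?S"
    using GS by (intro SUP_least) auto
  finally show ?thesis .
qed

lemma nn_integral_eq_infsum:
  fixes f :: "'a \<Rightarrow> real"
  assumes "f summable_on A" "\<And>x. 0 \<le> f x"
  shows "(\<integral>\<^sup>+x. ennreal (f x) \<partial>count_space A) = ennreal (infsum f A)"
proof -
  have "Infinite_Set_Sum.abs_summable_on f A"
    using assms by (simp flip: abs_summable_equivalent)
  then show ?thesis
    using assms by (simp add: nn_integral_conv_infsetsum infsetsum_infsum)
qed

lemma nn_integral_finite_imp_summable:
  fixes f :: "'a \<Rightarrow> real"
  assumes "(\<integral>\<^sup>+x. ennreal (f x) \<partial>count_space A) < \<infinity>" "\<And>x. 0 \<le> f x"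
  shows "f summable_on A"
proof -
  have "Infinite_Set_Sum.abs_summable_on f A"
    unfolding Infinite_Set_Sum.abs_summable_on_def
    by (rule integrableI_nonneg) (use assms in auto)
  then show ?thesis
    using assms by (simp flip: abs_summable_equivalent)
qed

text \<open>
  The regularity theorem on the side of the coefficients, where \<open>l\<close> is a length function on a countable group.
  For high frequencies, division by \<open>(l k)\<^sup>2 - L\<close> makes the convolution with \<open>c\<close> small in both the sup norm and
  the weighted \<open>\<ell>\<^sup>1\<close> norm, so that \<open>contraction_bound\<close> applies; the low frequencies are finitely many and form the
  inhomogeneity. Inserting the resulting summability into the inequality once more gains the factor
  \<open>(l k)\<^sup>2\<close>.
\<close>

theorem lattice_elliptic_regularity:
  fixes h :: "'j :: countable \<Rightarrow> 'a :: {ab_group_add, countable}"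
    and B l :: "'a \<Rightarrow> real" and c :: "'j \<Rightarrow> real" and s L M :: real
  assumes l: "\<And>k. 0 \<le> l k" "\<And>k m. l k \<le> l (k + m) + l m" "\<And>R. finite {k. l k \<le> R}"
    and B: "\<And>k. \<bar>B k\<bar> \<le> M"
    and c: "\<And>j. 0 \<le> c j" "(\<lambda>j. c j * (1 + l (h j)) powr s) summable_on UNIV"
    and "0 \<le> s" "0 \<le> L"
    and ineq: "\<And>k. (l k)\<^sup>2 * \<bar>B k\<bar> \<le> L * \<bar>B k\<bar> + (\<Sum>\<^sub>\<infinity>j. c j * \<bar>B (k + h j)\<bar>)"
  shows "(\<lambda>k. (1 + l k) powr s * (1 + (l k)\<^sup>2) * \<bar>B k\<bar>) summable_on UNIV"
proof -
  define b where "b k = ennreal \<bar>B k\<bar>" for k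
  define w where "w k = ennreal ((1 + l k) powr s)" for k
  define w' where "w' j = ennreal ((1 + l (h j)) powr s)" for j
  define c' where "c' j = ennreal (c j)" for j
  define C where "C = (\<Sum>\<^sub>\<infinity>j. c j * (1 + l (h j)) powr s)"
  \<comment> \<open>Above this threshold the kernel has total mass at most \<open>C / K \<le> 1 / 2\<close>; adding 1 keeps \<open>K\<close> positive.\<close>
  define K where "K = 2 * (C + 1)"
  define low where "low k \<longleftrightarrow> (l k)\<^sup>2 \<le> L + K" for k
  let ?S = "shift_sum h c'"
  define T where "T v k = (if low k then 0 else ennreal (1 / K) * ?S v k)" for v k
  define F where "F k = (if low k then b k else 0)" for k
  have M: "0 \<le> M" using B[of 0] by linarith
  have C: "0 \<le> C" unfolding C_def by (intro infsum_nonneg mult_nonneg_nonneg c) auto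
  have KC: "K > 0" "1 / K * C \<le> 1 / 2" using C by (auto simp: K_def field_simps)
  have cw: "(\<integral>\<^sup>+j. c' j * w' j \<partial>count_space UNIV) = ennreal C"
    using nn_integral_eq_infsum[OF c(2)] c(1)
    by (simp add: C_def c'_def w'_def ennreal_mult)
  have ge1: "1 \<le> (1 + l k) powr s" for k
    using l(1)[of k] \<open>0 \<le> s\<close> by (simp add: ge_one_powr_ge_zero)
  have "c j \<le> c j * (1 + l (h j)) powr s" for j
    using mult_left_mono[OF ge1 c(1)] by simp
  then have csum: "c summable_on UNIV"
    by (intro summable_on_comparison_test[OF c(2)]) (auto simp: c)
  have cC: "(\<integral>\<^sup>+j. c' j \<partial>count_space UNIV) \<le> ennreal C"
    unfolding cw[symmetric]
  proof (intro nn_integral_mono)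
    fix j
    have "c' j * 1 \<le> c' j * w' j"
      using ge1[of "h j"] by (intro mult_left_mono) (auto simp: w'_def simp flip: ennreal_1)
    then show "c' j \<le> c' j * w' j" by simp
  qed
  have half: "ennreal (1 / K) * (ennreal C * a) \<le> ennreal (1 / 2) * a" for a
  proof -
    have "ennreal (1 / K) * ennreal C = ennreal (1 / K * C)"
      using KC C by (intro ennreal_mult[symmetric]) auto
    also have "\<dots> \<le> ennreal (1 / 2)" by (rule ennreal_leI[OF KC(2)])
    finally show ?thesis unfolding mult.assoc[symmetric] by (rule mult_right_mono) simp
  qed
  have ww: "w k \<le> w (k + h j) * w' j" for k j
  proof -
    have "(1 + l k) \<le> (1 + l (k + h j)) * (1 + l (h j))"
      using l(2)[of k "h j"] mult_nonneg_nonneg[OF l(1)[of "k + h j"] l(1)[of "h j"]]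
      by (simp add: algebra_simps)
    then have "(1 + l k) powr s \<le> ((1 + l (k + h j)) * (1 + l (h j))) powr s"
      using l(1)[of k] \<open>0 \<le> s\<close> by (intro powr_mono2) auto
    then show ?thesis
      using l(1) by (simp add: w_def w'_def powr_mult flip: ennreal_mult)
  qed
  have Sb: "?S b k = ennreal (\<Sum>\<^sub>\<infinity>j. c j * \<bar>B (k + h j)\<bar>)" for k
  proof -
    have "(\<lambda>j. c j * \<bar>B (k + h j)\<bar>) summable_on UNIV"
      by (rule summable_on_comparison_test[OF summable_on_cmult_left[OF csum, of M]])
        (auto intro!: mult_left_mono mult_nonneg_nonneg B c)
    from nn_integral_eq_infsum[OF this mult_nonneg_nonneg[OF c(1) abs_ge_zero]] c(1) show ?thesis
      by (simp add: shift_sum_def b_def c'_def ennreal_mult)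
  qed
  have wS: "(\<integral>\<^sup>+k. w k * ?S v k \<partial>count_space UNIV) \<le> ennreal C * (\<integral>\<^sup>+k. w k * v k \<partial>count_space UNIV)" for v
    using weighted_shift_sum_le[of w h w' c' v] ww cw by simp
  have "(\<integral>\<^sup>+k. w k * b k \<partial>count_space UNIV) \<le> 2 * (\<integral>\<^sup>+k. w k * F k \<partial>count_space UNIV)"
  proof (rule contraction_bound[where M = M and T = T])
    show "b k \<le> ennreal M" for k unfolding b_def by (rule ennreal_leI[OF B])
    show "b k \<le> T b k + F k" for k
    proof (cases "low k")
      case False
      then have "K * \<bar>B k\<bar> \<le> ((l k)\<^sup>2 - L) * \<bar>B k\<bar>"
        by (intro mult_right_mono) (auto simp: low_def)
      also have "\<dots> \<le> (\<Sum>\<^sub>\<infinity>j. c j * \<bar>B (k + h j)\<bar>)"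
        using ineq[of k] by (simp add: algebra_simps)
      finally have "\<bar>B k\<bar> \<le> 1 / K * (\<Sum>\<^sub>\<infinity>j. c j * \<bar>B (k + h j)\<bar>)"
        using KC(1) by (simp add: field_simps)
      then have "b k \<le> ennreal (1 / K * (\<Sum>\<^sub>\<infinity>j. c j * \<bar>B (k + h j)\<bar>))"
        unfolding b_def by (rule ennreal_leI)
      also have "\<dots> = ennreal (1 / K) * ennreal (\<Sum>\<^sub>\<infinity>j. c j * \<bar>B (k + h j)\<bar>)"
        using KC(1) by (intro ennreal_mult infsum_nonneg mult_nonneg_nonneg c) auto
      also have "\<dots> = T b k" using False by (simp add: T_def Sb)
      finally show ?thesis by (simp add: F_def False)
    qed (simp add: F_def)
    show "T v k \<le> T v' k" if "\<And>k. v k \<le> v' k" for v v' k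
      using shift_sum_mono[of v v' h c' k, OF that] by (auto simp: T_def intro!: mult_left_mono)
    show "T (\<lambda>k. v k + a) k \<le> T v k + ennreal (1 / 2) * a" for v a k
    proof (cases "low k")
      case False
      have "ennreal (1 / K) * ((\<integral>\<^sup>+j. c' j \<partial>count_space UNIV) * a) \<le> ennreal (1 / K) * (ennreal C * a)"
        by (intro mult_left_mono mult_right_mono cC) auto
      also note half
      finally show ?thesis
        using False by (simp add: T_def shift_sum_add_const distrib_left)
    qed (simp add: T_def)
    show "(\<integral>\<^sup>+k. w k * T v k \<partial>count_space UNIV) \<le>
        ennreal (1 / 2) * (\<integral>\<^sup>+k. w k * v k \<partial>count_space UNIV)" for v
    proof -
      have "(\<integral>\<^sup>+k. w k * T v k \<partial>count_space UNIV) \<le>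
          (\<integral>\<^sup>+k. ennreal (1 / K) * (w k * ?S v k) \<partial>count_space UNIV)"
        by (intro nn_integral_mono) (simp add: T_def mult_ac)
      also have "\<dots> = ennreal (1 / K) * (\<integral>\<^sup>+k. w k * ?S v k \<partial>count_space UNIV)"
        by (simp add: nn_integral_cmult)
      also have "\<dots> \<le> ennreal (1 / K) * (ennreal C * (\<integral>\<^sup>+k. w k * v k \<partial>count_space UNIV))"
        by (intro mult_left_mono wS) auto
      also note half
      finally show ?thesis .
    qed
  qed (rule M)
  also have "(\<integral>\<^sup>+k. w k * F k \<partial>count_space UNIV) < \<infinity>"
  proof -
    have "{k. low k} \<subseteq> {k. l k \<le> sqrt (L + K)}"
      by (auto simp: low_def intro: real_le_rsqrt)
    then have "finite {k. low k}" using l(3) finite_subset by blast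
    then have "(\<integral>\<^sup>+k. w k * F k \<partial>count_space UNIV) = (\<Sum>k | low k. w k * F k)"
      by (rule nn_integral_count_space') (auto simp: F_def)
    also have "\<dots> = ennreal (\<Sum>k | low k. (1 + l k) powr s * \<bar>B k\<bar>)"
      by (simp add: F_def w_def b_def ennreal_mult flip: sum_ennreal)
    finally show ?thesis by simp
  qed
  then have "2 * (\<integral>\<^sup>+k. w k * F k \<partial>count_space UNIV) < \<infinity>"
    by (simp add: ennreal_mult_less_top)
  finally have W: "(\<integral>\<^sup>+k. w k * b k \<partial>count_space UNIV) < \<infinity>" .
  \<comment> \<open>The gain of two powers: use the inequality again, now for a summable sequence.\<close>
  have "(\<integral>\<^sup>+k. ennreal ((1 + l k) powr s * (1 + (l k)\<^sup>2) * \<bar>B k\<bar>) \<partial>count_space UNIV) \<le>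
      (\<integral>\<^sup>+k. ennreal (1 + L) * (w k * b k) + w k * ?S b k \<partial>count_space UNIV)"
  proof (intro nn_integral_mono)
    fix k
    let ?\<Sigma> = "\<Sum>\<^sub>\<infinity>j. c j * \<bar>B (k + h j)\<bar>"
    have "0 \<le> ?\<Sigma>" by (intro infsum_nonneg mult_nonneg_nonneg c) auto
    have "(1 + l k) powr s * ((1 + (l k)\<^sup>2) * \<bar>B k\<bar>) \<le> (1 + l k) powr s * ((1 + L) * \<bar>B k\<bar> + ?\<Sigma>)"
      using ineq[of k] by (intro mult_left_mono) (auto simp: algebra_simps)
    also have "\<dots> = (1 + L) * ((1 + l k) powr s * \<bar>B k\<bar>) + (1 + l k) powr s * ?\<Sigma>"
      by (simp add: algebra_simps)
    finally have "ennreal ((1 + l k) powr s * (1 + (l k)\<^sup>2) * \<bar>B k\<bar>) \<le>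
        ennreal ((1 + L) * ((1 + l k) powr s * \<bar>B k\<bar>) + (1 + l k) powr s * ?\<Sigma>)"
      by (intro ennreal_leI) (simp add: mult.assoc)
    also have "\<dots> = ennreal (1 + L) * (w k * b k) + w k * ?S b k"
      using \<open>0 \<le> L\<close> \<open>0 \<le> ?\<Sigma>\<close> by (simp add: w_def b_def Sb ennreal_mult)
    finally show "ennreal ((1 + l k) powr s * (1 + (l k)\<^sup>2) * \<bar>B k\<bar>) \<le> \<dots>" .
  qed
  also have "\<dots> = ennreal (1 + L) * (\<integral>\<^sup>+k. w k * b k \<partial>count_space UNIV) + (\<integral>\<^sup>+k. w k * ?S b k \<partial>count_space UNIV)"
    by (simp add: nn_integral_add nn_integral_cmult)
  also have "\<dots> \<le> ennreal (1 + L) * (\<integral>\<^sup>+k. w k * b k \<partial>count_space UNIV) + ennreal C * (\<integral>\<^sup>+k. w k * b k \<partial>count_space UNIV)"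
    by (intro add_left_mono wS)
  also have "\<dots> < \<infinity>"
    using W by (simp add: ennreal_mult_less_top)
  finally show ?thesis
    by (rule nn_integral_finite_imp_summable) simp
qed

section \<open>Regularity of the ground state\<close>

definition int_norm1 :: "int ^ 'n \<Rightarrow> real" where
  "int_norm1 k = (\<Sum>i\<in>UNIV. \<bar>real_of_int (k $ i)\<bar>)"

lemma int_norm1_nonneg: "0 \<le> int_norm1 k"
  by (simp add: int_norm1_def sum_nonneg)

lemma int_norm1_triangle: "int_norm1 k \<le> int_norm1 (k + m) + int_norm1 m"
  unfolding int_norm1_def sum.distrib[symmetric] by (rule sum_mono) auto

lemma finite_int_norm1_le: "finite {k :: int ^ 'n. int_norm1 k \<le> R}"
proof (rule finite_subset)
  show "{k :: int ^ 'n. int_norm1 k \<le> R} \<subseteq> vec_lambda ` (PiE UNIV (\<lambda>_. {- \<lfloor>R\<rfloor>..\<lfloor>R\<rfloor>}))"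
  proof
    fix k :: "int ^ 'n" assume k: "k \<in> {k. int_norm1 k \<le> R}"
    have "k $ i \<in> {- \<lfloor>R\<rfloor>..\<lfloor>R\<rfloor>}" for i
    proof -
      have "\<bar>real_of_int (k $ i)\<bar> \<le> int_norm1 k"
        unfolding int_norm1_def by (rule member_le_sum) auto
      then have "real_of_int \<bar>k $ i\<bar> \<le> R" using k by simp
      then have "\<bar>k $ i\<bar> \<le> \<lfloor>R\<rfloor>" by (simp only: le_floor_iff)
      then show ?thesis by auto
    qed
    then show "k \<in> vec_lambda ` (PiE UNIV (\<lambda>_. {- \<lfloor>R\<rfloor>..\<lfloor>R\<rfloor>}))"
      by (intro image_eqI[of _ _ "vec_nth k"]) auto
  qed
qed (intro finite_imageI finite_PiE, auto)

lemma int_norm1_signed: "int_norm1 (signed_index \<sigma> m) = real (index_norm1 m)"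
  by (auto simp: int_norm1_def index_norm1_def signed_index_nth intro!: sum.cong)

lemma int_norm1_power2_le:
  fixes k :: "int ^ 'n"
  shows "(int_norm1 k)\<^sup>2 \<le> real CARD('n) * (\<Sum>i\<in>UNIV. (real_of_int (k $ i))\<^sup>2)"
  using sum_squared_le_sum_of_squares[of "\<lambda>i. \<bar>real_of_int (k $ i)\<bar>" UNIV]
  by (simp add: int_norm1_def mult.commute)

lemma inj_signed_index: "inj (signed_index \<sigma>)"
  by (auto intro!: injI simp: vec_eq_iff signed_index_nth split: if_splits)

text \<open>
  The next two lemmas compare the weights of the Barron norms with \<open>(1 + l) powr s\<close>, which is submultiplicative
  along sums of frequencies.
\<close>

lemma one_plus_powr_le:
  fixes l s :: real
  assumes "0 \<le> l" "0 \<le> s"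
  shows "(1 + l) powr s \<le> 2 powr s * (1 + pi powr s * l powr s)"
proof (cases "l \<le> 1")
  case True
  then have "(1 + l) powr s \<le> 2 powr s" using assms by (intro powr_mono2) auto
  also have "\<dots> \<le> 2 powr s * (1 + pi powr s * l powr s)" by simp
  finally show ?thesis .
next
  case False
  have "1 \<le> pi powr s" using pi_ge_two assms by (intro ge_one_powr_ge_zero) auto
  then have "1 * l powr s \<le> pi powr s * l powr s" by (intro mult_right_mono) auto
  moreover have "(1 + l) powr s \<le> (2 * l) powr s" using assms False by (intro powr_mono2) auto
  moreover have "(2 * l) powr s = 2 powr s * l powr s" using assms by (simp add: powr_mult)
  ultimately have "(1 + l) powr s \<le> 2 powr s * l powr s" by linarith
  also have "\<dots> \<le> 2 powr s * (1 + pi powr s * l powr s)"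
    using \<open>1 * l powr s \<le> pi powr s * l powr s\<close> by (intro mult_left_mono) auto
  finally show ?thesis .
qed

lemma powr_add_two_le:
  fixes l s :: real
  assumes "0 \<le> l" "0 \<le> s"
  shows "1 + pi powr (s + 2) * l powr (s + 2) \<le> (1 + pi powr (s + 2)) * ((1 + l) powr s * (1 + l\<^sup>2))"
proof -
  have 1: "1 \<le> (1 + l) powr s" using assms by (intro ge_one_powr_ge_zero) auto
  have "l powr s \<le> (1 + l) powr s" using assms by (intro powr_mono2) auto
  then have "l powr s * l\<^sup>2 \<le> (1 + l) powr s * (1 + l\<^sup>2)" by (intro mult_mono) auto
  moreover have "l powr (s + 2) = l powr s * l\<^sup>2"
    using assms by (cases "l = 0") (auto simp: powr_add powr_numeral)
  ultimately have "pi powr (s + 2) * l powr (s + 2) \<le> pi powr (s + 2) * ((1 + l) powr s * (1 + l\<^sup>2))"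
    by (intro mult_left_mono) auto
  moreover have "1 \<le> (1 + l) powr s * (1 + l\<^sup>2)"
    using mult_mono[OF 1, of 1 "1 + l\<^sup>2"] by simp
  ultimately show ?thesis
    unfolding distrib_right[of 1] mult_1_left by (intro add_mono)
qed

lemma barron_space_if_moments_summable:
  fixes u :: "real ^ 'n \<Rightarrow> real"
  assumes u: "integrable cube_measure u" and "0 \<le> s"
    and sum: "(\<lambda>k. (1 + int_norm1 k) powr s * (1 + (int_norm1 k)\<^sup>2) * \<bar>moment u k\<bar>) summable_on UNIV"
  shows "u \<in> barron_space (s + 2)"
proof -
  let ?e = "signed_index (\<lambda>_. True) :: nat ^ 'n \<Rightarrow> int ^ 'n"
  let ?f = "\<lambda>k. (1 + int_norm1 k) powr s * (1 + (int_norm1 k)\<^sup>2) * \<bar>moment u k\<bar>"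
  let ?C = "(1 + pi powr (s + 2)) * 2 ^ CARD('n)"
  have "?f summable_on range ?e"
    by (rule summable_on_subset_banach[OF sum]) simp
  then have "(?f \<circ> ?e) summable_on UNIV"
    using summable_on_reindex[OF inj_signed_index] by blast
  then have "(\<lambda>m. ?C * (?f (?e m))) summable_on UNIV"
    by (intro summable_on_cmult_right) (simp add: o_def)
  then have "(\<lambda>m. (1 + pi powr (s + 2) * real (index_norm1 m) powr (s + 2)) * \<bar>cos_coeff u m\<bar>) summable_on UNIV"
  proof (rule summable_on_comparison_test)
    fix m :: "nat ^ 'n"
    let ?l = "real (index_norm1 m)"
    have "(1 + pi powr (s + 2) * ?l powr (s + 2)) * \<bar>cos_coeff u m\<bar> \<le>
        ((1 + pi powr (s + 2)) * ((1 + ?l) powr s * (1 + ?l\<^sup>2))) * (2 ^ CARD('n) * \<bar>moment u (?e m)\<bar>)"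
      by (intro mult_mono powr_add_two_le abs_cos_coeff_le) (use \<open>0 \<le> s\<close> in auto)
    then show "(1 + pi powr (s + 2) * ?l powr (s + 2)) * \<bar>cos_coeff u m\<bar> \<le> ?C * (?f (?e m))"
      by (simp add: int_norm1_signed mult_ac)
  qed auto
  then show ?thesis using u by (simp add: barron_space_def)
qed

theorem theorem2p5:
  fixes V u :: "real ^ 'n \<Rightarrow> real" and s Vmin Vmax :: real
  assumes "s \<ge> 0"
    and "V \<in> barron_space s"
    and "Vmin > 0" and "Vmax > 0"
    and "\<forall>x\<in>unit_cube. Vmin \<le> V x \<and> V x \<le> Vmax"
    and "ground_state V u"
  shows "u \<in> barron_space (s + 2)"
proof -
  let ?d = "real CARD('n)" and ?q = "\<lambda>m. \<bar>cos_coeff V m\<bar>"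
  have V: "V \<in> borel_measurable cube_measure"
    and VB: "(\<lambda>m. (1 + pi powr s * real (index_norm1 m) powr s) * ?q m) summable_on UNIV"
    using assms(2) by (auto simp: barron_space_def)
  have Vb: "\<bar>V x\<bar> \<le> Vmax" if "x \<in> unit_cube" for x using assms(3,5) that by force
  obtain \<mu> where u: "integrable cube_measure u" and eq:
    "\<And>k. pi\<^sup>2 * (\<Sum>i\<in>UNIV. (real_of_int (k $ i))\<^sup>2) * moment u k =
      \<mu> * moment u k - (LINT x|cube_measure. V x * u x * cos_mode k x)"
    using ground_state_moment_equation[OF assms(6) V Vb] by blast
  have qw: "(\<lambda>m. ?q m * (1 + real (index_norm1 m)) powr s) summable_on UNIV"
  proof (rule summable_on_comparison_test[OF summable_on_cmult_right[OF VB, of "2 powr s"]])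
    fix m :: "nat ^ 'n"
    show "?q m * (1 + real (index_norm1 m)) powr s \<le>
        2 powr s * ((1 + pi powr s * real (index_norm1 m) powr s) * ?q m)"
      using mult_left_mono[OF one_plus_powr_le[of "real (index_norm1 m)" s], of "?q m"] assms(1)
      by (simp add: mult_ac)
  qed auto
  have q: "?q summable_on UNIV"
  proof (rule summable_on_comparison_test[OF qw])
    fix m :: "nat ^ 'n"
    have "1 \<le> (1 + real (index_norm1 m)) powr s" using assms(1) by (intro ge_one_powr_ge_zero) auto
    then show "?q m \<le> ?q m * (1 + real (index_norm1 m)) powr s"
      using mult_left_mono[of 1 _ "?q m"] by simp
  qed auto
  have VAE: "AE x in cube_measure. V x = cos_series (cos_coeff V) x"
    by (rule AE_eq_cos_series[OF V Vb q])
  have pairs: "(\<lambda>(\<sigma> :: 'n \<Rightarrow> bool, m). C * f m) summable_on UNIV"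
    if "f summable_on UNIV" "\<And>m. 0 \<le> f m" "0 \<le> C" for f :: "nat ^ 'n \<Rightarrow> real" and C
  proof -
    have "(\<lambda>(\<sigma> :: 'n \<Rightarrow> bool, m). C * f m) summable_on (Sigma UNIV (\<lambda>_. UNIV))"
      by (rule summable_on_SigmaI[where g = "\<lambda>_. C * infsum f UNIV"])
        (use that in \<open>auto intro!: has_sum_cmult_right\<close>)
    then show ?thesis by simp
  qed
  define c :: "('n \<Rightarrow> bool) \<times> (nat ^ 'n) \<Rightarrow> real"
    where "c = (\<lambda>(\<sigma>, m). ?d / pi\<^sup>2 * (?q m / 2 ^ CARD('n)))"
  define h :: "('n \<Rightarrow> bool) \<times> (nat ^ 'n) \<Rightarrow> int ^ 'n" where "h = (\<lambda>(\<sigma>, m). signed_index \<sigma> m)"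
  let ?U = "LINT x|cube_measure. \<bar>u x\<bar>"
  have "(\<lambda>k. (1 + int_norm1 k) powr s * (1 + (int_norm1 k)\<^sup>2) * \<bar>moment u k\<bar>) summable_on UNIV"
  proof (rule lattice_elliptic_regularity[where c = c and h = h and M = ?U and L = "?d / pi\<^sup>2 * \<bar>\<mu>\<bar>"])
    show "\<bar>moment u k\<bar> \<le> ?U" for k by (rule abs_moment_le[OF u])
    show "0 \<le> c j" for j by (auto simp: c_def split: prod.split)
    have cw: "(\<lambda>j. c j * (1 + int_norm1 (h j)) powr s) =
        (\<lambda>(\<sigma>, m). (?d / pi\<^sup>2 / 2 ^ CARD('n)) * (?q m * (1 + real (index_norm1 m)) powr s))"
      by (auto simp: c_def h_def int_norm1_signed)
    show "(\<lambda>j. c j * (1 + int_norm1 (h j)) powr s) summable_on UNIV"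
      unfolding cw by (rule pairs[OF qw]) auto
    fix k :: "int ^ 'n"
    let ?t = "\<lambda>(\<sigma>, m). ?q m / 2 ^ CARD('n) * \<bar>moment u (k + signed_index \<sigma> m)\<bar>"
    have summ: "?t summable_on UNIV"
    proof (rule summable_on_comparison_test[OF pairs[OF q, of "?U / 2 ^ CARD('n)"]])
      show "?t j \<le> (case j of (\<sigma>, m) \<Rightarrow> ?U / 2 ^ CARD('n) * ?q m)" for j
        using mult_left_mono[OF abs_moment_le[OF u]]
        by (auto simp: field_simps split: prod.split)
    qed (auto split: prod.split)
    let ?S = "\<Sum>i\<in>UNIV. (real_of_int (k $ i))\<^sup>2"
    have "pi\<^sup>2 * (?S * \<bar>moment u k\<bar>) = \<bar>pi\<^sup>2 * ?S * moment u k\<bar>"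
      by (simp add: abs_mult sum_nonneg)
    also have "\<dots> \<le> \<bar>\<mu>\<bar> * \<bar>moment u k\<bar> + \<bar>LINT x|cube_measure. V x * u x * cos_mode k x\<bar>"
      unfolding eq abs_mult[symmetric] by (rule abs_triangle_ineq4)
    also have "\<dots> \<le> \<bar>\<mu>\<bar> * \<bar>moment u k\<bar> + infsum ?t UNIV"
      by (intro add_left_mono abs_moment_mult_le[OF VAE q u V summ])
    finally have "?S * \<bar>moment u k\<bar> \<le> (\<bar>\<mu>\<bar> * \<bar>moment u k\<bar> + infsum ?t UNIV) / pi\<^sup>2"
      by (simp add: pos_le_divide_eq mult.commute)
    then have "?d * (?S * \<bar>moment u k\<bar>) \<le> ?d * ((\<bar>\<mu>\<bar> * \<bar>moment u k\<bar> + infsum ?t UNIV) / pi\<^sup>2)"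
      by (rule mult_left_mono) simp
    moreover have "(int_norm1 k)\<^sup>2 * \<bar>moment u k\<bar> \<le> ?d * ?S * \<bar>moment u k\<bar>"
      by (intro mult_right_mono int_norm1_power2_le) simp
    moreover have "?d / pi\<^sup>2 * infsum ?t UNIV = (\<Sum>\<^sub>\<infinity>j. c j * \<bar>moment u (k + h j)\<bar>)"
    proof -
      have "?d / pi\<^sup>2 * infsum ?t UNIV = (\<Sum>\<^sub>\<infinity>j. ?d / pi\<^sup>2 * ?t j)"
        by (rule infsum_cmult_right[symmetric]) (use summ in blast)
      also have "\<dots> = (\<Sum>\<^sub>\<infinity>j. c j * \<bar>moment u (k + h j)\<bar>)"
        by (rule infsum_cong) (auto simp: c_def h_def mult_ac)
      finally show ?thesis .
    qed
    ultimately show "(int_norm1 k)\<^sup>2 * \<bar>moment u k\<bar> \<le>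
        ?d / pi\<^sup>2 * \<bar>\<mu>\<bar> * \<bar>moment u k\<bar> + (\<Sum>\<^sub>\<infinity>j. c j * \<bar>moment u (k + h j)\<bar>)"
      by (simp add: add_divide_distrib distrib_left mult.assoc)
  qed (use assms(1) int_norm1_nonneg int_norm1_triangle finite_int_norm1_le in auto)
  then show ?thesis by (rule barron_space_if_moments_summable[OF u assms(1)])
qed

end
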